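(* Let $n\geq3$ and let $B$ be a real $(n-1)\times(n-1)$ matrix. Consider $$X_B:W_B\times I_B\times[-1,1]^{n-1}\to\mathbb{R}^{n-1},\qquad X_B(w,t;y)=w+(tI+t^2B)y,$$ where $I_B=[-\tau_B,\tau_B]$ with $\tau_B>0$ small enough that $X_B$ satisfies H\"ormander's conditions, and $W_B\subset\mathbb{R}^{n-1}$ is a sufficiently large compact ball depending on $B$ (i.e. there is $r_B>0$ such that the following holds whenever $W_B$ is a compact ball containing the closed ball of radius $r_B$ about the origin). If the linear Kakeya set conjecture holds in dimension $n+\operatorname{rank}B^2$, then $$d_{\mathrm{Kak}}(X_B)=n-\operatorname{rank}B+\operatorname{rank}B^2.$$ The minimum is attained by an $X_B$-Kakeya set contained in a smooth variety in $\mathbb{R}^n$ of dimension $n-\operatorname{rank}B+\operatorname{rank}B^2$. In particular, conditional on the linear Kakeya set conjecture in all dimensions, the numbers $d_{\mathrm{Kak}}(X_B)$ are integers.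
   Context: Linear Kakeya set conjecture in dimension $N$: every compact subset of $\mathbb{R}^N$ containing a line segment in each direction has Hausdorff dimension $N$. For a smooth map $X:W\times I\times Y\to\mathbb{R}^{n-1}$, $(w,t,y)\mapsto X(w,t;y)$, with $W,Y\subset\mathbb{R}^{n-1}$ compact (balls or cubes) and $I\subset\mathbb{R}$ a compact interval, H\"ormander's conditions are $\det\nabla_wX\neq0$ and $\det\partial_t[(\nabla_wX)^{-1}\nabla_yX]\neq0$ everywhere on $W\times I\times Y$. For $(y,w)\in Y\times W$ let $\gamma_{y,w}=\{(X(w,t;y),t):t\in I\}\subset\mathbb{R}^n$. An $X$-Kakeya set is a compact set $K\subset\mathbb{R}^n$ such that for each $y\in Y$ there is $w(y)\in W$ with $\gamma_{y,w(y)}\subset K$. Define $d_{\mathrm{Kak}}(X)=\inf\{\dim_{\mathrm H}K: K\text{ is an }X\text{-Kakeya set}\}$, where $\dim_{\mathrm H}$ is Hausdorff dimension. "Smooth variety" means a smooth real algebraic variety in $\mathbb{R}^n$. *)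

theory Defs
  imports "HOL-Analysis.Analysis"
begin

section \<open>Hausdorff dimension in a metric space\<close>

definition mdiam :: "'a metric \<Rightarrow> 'a set \<Rightarrow> ennreal" where
  "mdiam m U = (SUP x\<in>U. SUP y\<in>U. ennreal (mdist m x y))"

text \<open>The cost \<open>(diam U)\<^sup>s\<close> of a covering set of finite diameter, with the usual conventions
  that the empty set costs nothing and that \<open>0\<^sup>0 = 1\<close> (whereas \<open>0 powr 0 = 0\<close>).\<close>

definition diam_pow :: "'a metric \<Rightarrow> real \<Rightarrow> 'a set \<Rightarrow> ennreal" where
  "diam_pow m s U =
     (if U = {} then 0 else if s = 0 then 1 else ennreal (enn2real (mdiam m U) powr s))"

definition hausdorff_premeasure :: "'a metric \<Rightarrow> real \<Rightarrow> real \<Rightarrow> 'a set \<Rightarrow> ennreal" where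
  "hausdorff_premeasure m s \<delta> S =
     (INF U \<in> {U :: nat \<Rightarrow> 'a set.
                 (\<forall>i. U i \<subseteq> mspace m \<and> mdiam m (U i) \<le> ennreal \<delta>) \<and> S \<subseteq> (\<Union>i. U i)}.
        \<Sum>i. diam_pow m s (U i))"

definition hausdorff_measure :: "'a metric \<Rightarrow> real \<Rightarrow> 'a set \<Rightarrow> ennreal" where
  "hausdorff_measure m s S = (SUP \<delta>\<in>{0<..}. hausdorff_premeasure m s \<delta> S)"

definition hausdorff_dim :: "'a metric \<Rightarrow> 'a set \<Rightarrow> ereal" where
  "hausdorff_dim m S = Inf {ereal s |s. 0 \<le> s \<and> hausdorff_measure m s S = 0}"

section \<open>The linear Kakeya set conjecture\<close>

text \<open>The dimension is a natural number that depends on other data (and is quantified over), so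
  \<open>\<real>\<^sup>N\<close> is modelled here by the sequences vanishing from index \<open>N\<close> on, as in the library's
  \<^const>\<open>Euclidean_space\<close>, with the Euclidean metric.\<close>

definition Rn_metric :: "nat \<Rightarrow> (nat \<Rightarrow> real) metric" where
  "Rn_metric N = metric ({x. \<forall>i\<ge>N. x i = 0}, \<lambda>x y. L2_set (\<lambda>i. x i - y i) {..<N})"

lemma Metric_space_Rn:
  "Metric_space {x. \<forall>i\<ge>(N::nat). x i = (0::real)} (\<lambda>x y. L2_set (\<lambda>i. x i - y i) {..<N})"
proof
  fix x y z :: "nat \<Rightarrow> real"
  show "0 \<le> L2_set (\<lambda>i. x i - y i) {..<N}"
    by simp
  show "L2_set (\<lambda>i. x i - y i) {..<N} = L2_set (\<lambda>i. y i - x i) {..<N}"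
    by (simp add: L2_set_def power2_commute)
  have "L2_set (\<lambda>i. (x i - y i) + (y i - z i)) {..<N}
      \<le> L2_set (\<lambda>i. x i - y i) {..<N} + L2_set (\<lambda>i. y i - z i) {..<N}"
    by (rule L2_set_triangle_ineq)
  then show "L2_set (\<lambda>i. x i - z i) {..<N}
      \<le> L2_set (\<lambda>i. x i - y i) {..<N} + L2_set (\<lambda>i. y i - z i) {..<N}"
    by simp
  assume "x \<in> {x. \<forall>i\<ge>N. x i = 0}" "y \<in> {x. \<forall>i\<ge>N. x i = 0}"
  then show "(L2_set (\<lambda>i. x i - y i) {..<N} = 0) = (x = y)"
    by (auto simp: L2_set_eq_0_iff fun_eq_iff) (metis lessThan_iff not_le)
qed

lemma mspace_Rn_metric [simp]: "mspace (Rn_metric N) = {x. \<forall>i\<ge>N. x i = 0}"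
  by (simp add: Rn_metric_def Metric_space_Rn Metric_space.mspace_metric)

lemma mdist_Rn_metric [simp]:
  "mdist (Rn_metric N) = (\<lambda>x y. L2_set (\<lambda>i. x i - y i) {..<N})"
  by (simp add: Rn_metric_def Metric_space_Rn Metric_space.mdist_metric)

text \<open>Directions are given by nonzero vectors; the segments are nondegenerate and of
  arbitrary positive length.\<close>

definition linear_kakeya_set :: "nat \<Rightarrow> (nat \<Rightarrow> real) set \<Rightarrow> bool" where
  "linear_kakeya_set N K \<longleftrightarrow>
     compactin (mtopology_of (Rn_metric N)) K \<and>
     (\<forall>e \<in> mspace (Rn_metric N). e \<noteq> (\<lambda>_. 0) \<longrightarrow>
        (\<exists>a \<in> mspace (Rn_metric N). \<exists>l>0. \<forall>s\<in>{0..l}. (\<lambda>i. a i + s * e i) \<in> K))"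

definition linear_kakeya_conjecture :: "nat \<Rightarrow> bool" where
  "linear_kakeya_conjecture N \<longleftrightarrow>
     (\<forall>K. linear_kakeya_set N K \<longrightarrow> hausdorff_dim (Rn_metric N) K = ereal (real N))"

section \<open>Curved Kakeya sets\<close>

text \<open>With \<open>n - 1 = CARD('m)\<close>, the space \<open>\<real>\<^sup>n\<close> is the product \<^typ>\<open>(real^'m) \<times> real\<close>.
  All derivatives are taken within the factor of the domain, so that
  they depend only on \<open>X\<close> on \<open>W \<times> I \<times> Y\<close>. They are meaningful for smooth \<open>X\<close> and for factors
  that are closed balls, cubes or intervals with nonempty interior.\<close>

type_synonym 'm curve_family = "real^'m \<Rightarrow> real \<Rightarrow> real^'m \<Rightarrow> real^'m"

definition grad_w ::
    "(real^'m::finite) set \<Rightarrow> 'm curve_family \<Rightarrow> real^'m \<Rightarrow> real \<Rightarrow> real^'m \<Rightarrow> real^'m^'m" where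
  "grad_w W X w t y = matrix (frechet_derivative (\<lambda>w'. X w' t y) (at w within W))"

definition grad_y ::
    "(real^'m::finite) set \<Rightarrow> 'm curve_family \<Rightarrow> real^'m \<Rightarrow> real \<Rightarrow> real^'m \<Rightarrow> real^'m^'m" where
  "grad_y Y X w t y = matrix (frechet_derivative (\<lambda>y'. X w t y') (at y within Y))"

definition hormander_conditions ::
    "(real^'m::finite) set \<Rightarrow> real set \<Rightarrow> (real^'m) set \<Rightarrow> 'm curve_family \<Rightarrow> bool" where
  "hormander_conditions W I Y X \<longleftrightarrow>
     (\<forall>w\<in>W. \<forall>t\<in>I. \<forall>y\<in>Y.
        det (grad_w W X w t y) \<noteq> 0 \<and>
        det (vector_derivative
               (\<lambda>t'. matrix_inv (grad_w W X w t' y) ** grad_y Y X w t' y) (at t within I)) \<noteq> 0)"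

definition kakeya_curve ::
    "real set \<Rightarrow> 'm::finite curve_family \<Rightarrow> real^'m \<Rightarrow> real^'m \<Rightarrow> ((real^'m) \<times> real) set" where
  "kakeya_curve I X y w = {(X w t y, t) |t. t \<in> I}"

definition kakeya_set ::
    "(real^'m::finite) set \<Rightarrow> real set \<Rightarrow> (real^'m) set \<Rightarrow> 'm curve_family \<Rightarrow>
     ((real^'m) \<times> real) set \<Rightarrow> bool" where
  "kakeya_set W I Y X K \<longleftrightarrow> compact K \<and> (\<forall>y\<in>Y. \<exists>w\<in>W. kakeya_curve I X y w \<subseteq> K)"

definition d_Kak ::
    "(real^'m::finite) set \<Rightarrow> real set \<Rightarrow> (real^'m) set \<Rightarrow> 'm curve_family \<Rightarrow> ereal" where
  "d_Kak W I Y X = (INF K \<in> {K. kakeya_set W I Y X K}. hausdorff_dim euclidean_metric K)"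

definition X_mat :: "real^'m^'m \<Rightarrow> 'm::finite curve_family" where
  "X_mat B w t y = w + (t *\<^sub>R mat 1 + t\<^sup>2 *\<^sub>R B) *v y"

section \<open>Smooth real algebraic varieties\<close>

definition real_algebraic_set :: "'a::euclidean_space set \<Rightarrow> bool" where
  "real_algebraic_set V \<longleftrightarrow>
     (\<exists>P. finite P \<and> (\<forall>p\<in>P. real_polynomial_function p) \<and> V = {x. \<forall>p\<in>P. p x = 0})"

definition vanishing_ideal :: "'a::euclidean_space set \<Rightarrow> ('a \<Rightarrow> real) set" where
  "vanishing_ideal V = {p. real_polynomial_function p \<and> (\<forall>x\<in>V. p x = 0)}"

text \<open>A nonempty real algebraic set all of whose points are nonsingular in dimension \<open>d\<close>, in the
  sense of Bochnak, Coste and Roy: near each point the set is cut out by \<open>dim - d\<close> polynomials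
  from its vanishing ideal whose gradients at that point are linearly independent.
  Irreducibility is not part of the definition.\<close>

definition smooth_variety :: "nat \<Rightarrow> 'a::euclidean_space set \<Rightarrow> bool" where
  "smooth_variety d V \<longleftrightarrow>
     real_algebraic_set V \<and> V \<noteq> {} \<and>
     (\<forall>x\<in>V. \<exists>Q g U.
        finite Q \<and> Q \<subseteq> vanishing_ideal V \<and> card Q + d = DIM('a) \<and>
        (\<forall>q\<in>Q. GDERIV q x :> g q) \<and> inj_on g Q \<and> independent (g ` Q) \<and>
        open U \<and> x \<in> U \<and> V \<inter> U = {z\<in>U. \<forall>q\<in>Q. q z = 0})"

end

theory Submission
  imports Defs
begin

text \<open>Lower bound: if \<open>p = v + t B y\<close> with \<open>v\<close> in the range of \<open>B\<close>, then along the curve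
  \<open>x = w + t y + t\<^sup>2 B y\<close> both \<open>x - t p\<close> and \<open>p - B (x - t p)\<close> are affine in \<open>t\<close>. So a Lipschitz image
  of the product of a curved Kakeya set with a \<open>rank B\<close>-dimensional ball contains segments in an open
  cone of directions of a space of dimension \<open>n + rank B\<^sup>2\<close>, and finitely many reflections of it form
  a linear Kakeya set. Upper bound: for \<open>\<eta>\<close> in the range of \<open>B\<close> and orthogonal to the range of \<open>B\<^sup>2\<close>,
  the position \<open>w\<close> can be chosen such that \<open>\<eta> \<bullet> x = t (B\<^sup>T\<eta> \<bullet> x)\<close> holds along all the curves; these
  \<open>rank B - rank B\<^sup>2\<close> independent equations define the variety.\<close>

text \<open>The quadratic term of a curve changes with \<open>y\<close>. The variable
  \<open>p\<close> lets one map remove it for all curves, because \<open>p\<close> may be chosen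
  afresh at each point of each curve; letting \<open>p\<close> run through a ball in the range of
  \<open>B\<close> costs \<open>rank B\<close> dimensions. The gain: the velocity of x - t p is y -
  v and that of p - B (x - t p) is B v, so the first can be prescribed in R^(n-1) and,
  independently, the second in the range of B^2. With time this makes n + rank B^2 dimensions of
  directions, and an exponent s at which the curved set is null satisfies n + rank B^2 \<le> s +
  rank B. The same difference rank B - rank B^2 counts the equations of the variety. On that side
  everything rests on one fact: the space of the vectors \<eta> is orthogonal to its image under
  B^T. This makes the conditions on \<open>w\<close> compatible, the gradients independent at every
  point, and the variety a graph.\<close>

section \<open>Null sets and Hausdorff dimension\<close>

text \<open>For \<open>s > 0\<close> this says that the \<open>s\<close>-dimensional Hausdorff measure vanishes. The radii of nonempty
  pieces are positive so that a piece can be multiplied by intervals of length \<open>r i\<close>.\<close>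

definition hnull :: "'a metric \<Rightarrow> real \<Rightarrow> 'a set \<Rightarrow> bool" where
  "hnull m s S \<longleftrightarrow>
     (\<forall>\<epsilon>>0. \<exists>(U :: nat \<Rightarrow> 'a set) r. S = (\<Union>i. U i) \<and>
        (\<forall>i. 0 \<le> r i \<and> (U i \<noteq> {} \<longrightarrow> 0 < r i) \<and> (\<forall>x\<in>U i. \<forall>y\<in>U i. mdist m x y \<le> r i)) \<and>
        (\<Sum>i. ennreal (r i powr s)) \<le> ennreal \<epsilon>)"

lemma hnullE:
  assumes "hnull m s S" "\<epsilon> > 0"
  obtains U :: "nat \<Rightarrow> 'a set" and r where "S = (\<Union>i. U i)" "\<And>i. 0 \<le> r i"
    "\<And>i. U i \<noteq> {} \<Longrightarrow> 0 < r i" "\<And>i x y. x \<in> U i \<Longrightarrow> y \<in> U i \<Longrightarrow> mdist m x y \<le> r i"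
    "(\<Sum>i. ennreal (r i powr s)) \<le> ennreal \<epsilon>"
  using assms unfolding hnull_def by metis

lemma hnull_subset:
  assumes "hnull m s S" "T \<subseteq> S"
  shows "hnull m s T"
  unfolding hnull_def
proof (intro allI impI)
  fix \<epsilon> :: real assume "\<epsilon> > 0"
  then obtain U r where U: "S = (\<Union>i::nat. U i)" "\<And>i. 0 \<le> r i"
    "\<And>i. U i \<noteq> {} \<Longrightarrow> 0 < r i" "\<And>i x y. x \<in> U i \<Longrightarrow> y \<in> U i \<Longrightarrow> mdist m x y \<le> r i"
    "(\<Sum>i. ennreal (r i powr s)) \<le> ennreal \<epsilon>"
    by (rule hnullE[OF assms(1)]) blast
  then show "\<exists>U r. T = (\<Union>i::nat. U i) \<and>
        (\<forall>i. 0 \<le> r i \<and> (U i \<noteq> {} \<longrightarrow> 0 < r i) \<and> (\<forall>x\<in>U i. \<forall>y\<in>U i. mdist m x y \<le> r i)) \<and>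
        (\<Sum>i. ennreal (r i powr s)) \<le> ennreal \<epsilon>"
    using assms(2) by (intro exI[of _ "\<lambda>i. U i \<inter> T"] exI[of _ r]) auto
qed

lemma suminf_prod_decode:
  fixes f :: "nat \<Rightarrow> nat \<Rightarrow> ennreal"
  shows "(\<Sum>k. case prod_decode k of (i, j) \<Rightarrow> f i j) = (\<Sum>i. \<Sum>j. f i j)"
  using suminf_ennreal_2dimen[of "\<lambda>i. \<Sum>j. f i j" "\<lambda>(i, j). f i j"] by (simp add: o_def)

text \<open>Refining every piece of a cover, or covering every set of a sequence, yields doubly
  indexed pieces; \<open>prod_decode\<close> puts them into one sequence.\<close>

lemma hnull_doubleI:
  assumes "\<And>\<epsilon>. \<epsilon> > 0 \<Longrightarrow> \<exists>(U :: nat \<Rightarrow> nat \<Rightarrow> 'a set) r. S = (\<Union>i j. U i j) \<and>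
    (\<forall>i j. 0 \<le> r i j \<and> (U i j \<noteq> {} \<longrightarrow> 0 < r i j) \<and>
       (\<forall>x\<in>U i j. \<forall>y\<in>U i j. mdist m x y \<le> r i j)) \<and>
    (\<Sum>i. \<Sum>j. ennreal (r i j powr s)) \<le> ennreal \<epsilon>"
  shows "hnull m s S"
  unfolding hnull_def
proof (intro allI impI)
  fix \<epsilon> :: real assume "\<epsilon> > 0"
  from assms[OF this] obtain U :: "nat \<Rightarrow> nat \<Rightarrow> 'a set" and r where U: "S = (\<Union>i j. U i j)"
    and r: "\<And>i j. 0 \<le> r i j \<and> (U i j \<noteq> {} \<longrightarrow> 0 < r i j) \<and>
       (\<forall>x\<in>U i j. \<forall>y\<in>U i j. mdist m x y \<le> r i j)"
    and sum: "(\<Sum>i. \<Sum>j. ennreal (r i j powr s)) \<le> ennreal \<epsilon>"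
    by blast
  let ?U = "\<lambda>k. case prod_decode k of (i, j) \<Rightarrow> U i j"
  let ?r = "\<lambda>k. case prod_decode k of (i, j) \<Rightarrow> r i j"
  have 1: "S = (\<Union>k. ?U k)"
  proof (intro equalityI subsetI)
    fix x assume "x \<in> S"
    then obtain i j where "x \<in> U i j"
      using U by blast
    then show "x \<in> (\<Union>k. ?U k)"
      by (intro UN_I[of "prod_encode (i, j)"]) auto
  next
    fix x assume "x \<in> (\<Union>k. ?U k)"
    then obtain k where "x \<in> ?U k"
      by (rule UN_E)
    then show "x \<in> S"
      unfolding U by (cases "prod_decode k") auto
  qed
  have 2: "0 \<le> ?r k \<and> (?U k \<noteq> {} \<longrightarrow> 0 < ?r k) \<and> (\<forall>x\<in>?U k. \<forall>y\<in>?U k. mdist m x y \<le> ?r k)" for k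
    using r by (auto split: prod.splits)
  have "(\<Sum>k. ennreal (?r k powr s)) = (\<Sum>k. case prod_decode k of (i, j) \<Rightarrow> ennreal (r i j powr s))"
    by (intro suminf_cong) (auto split: prod.splits)
  also have "\<dots> = (\<Sum>i. \<Sum>j. ennreal (r i j powr s))"
    by (rule suminf_prod_decode)
  finally have 3: "(\<Sum>k. ennreal (?r k powr s)) \<le> ennreal \<epsilon>"
    using sum by simp
  show "\<exists>U r. S = (\<Union>i. U i) \<and>
        (\<forall>i. 0 \<le> r i \<and> (U i \<noteq> {} \<longrightarrow> 0 < r i) \<and> (\<forall>x\<in>U i. \<forall>y\<in>U i. mdist m x y \<le> r i)) \<and>
        (\<Sum>i. ennreal (r i powr s)) \<le> ennreal \<epsilon>"
    using 1 2 3 by (intro exI[of _ ?U] exI[of _ ?r] conjI allI) auto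
qed

lemma suminf_ennreal_half_powers:
  assumes "\<epsilon> > 0"
  shows "(\<Sum>i. ennreal (\<epsilon> * (1/2) ^ Suc i)) = ennreal \<epsilon>"
proof (rule suminf_ennreal_eq)
  show "(\<lambda>i. \<epsilon> * (1/2) ^ Suc i) sums \<epsilon>"
    using sums_mult[OF power_half_series, of \<epsilon>] by simp
qed (use assms in auto)

lemma hnull_UN:
  assumes "\<And>j::nat. hnull m s (S j)"
  shows "hnull m s (\<Union>j. S j)"
proof (rule hnull_doubleI)
  fix \<epsilon> :: real assume e: "\<epsilon> > 0"
  have "\<exists>(U :: nat \<Rightarrow> 'a set) r. S j = (\<Union>i. U i) \<and>
        (\<forall>i. 0 \<le> r i \<and> (U i \<noteq> {} \<longrightarrow> 0 < r i) \<and> (\<forall>x\<in>U i. \<forall>y\<in>U i. mdist m x y \<le> r i)) \<and>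
        (\<Sum>i. ennreal (r i powr s)) \<le> ennreal (\<epsilon> * (1/2) ^ Suc j)" for j
    using assms[of j] e unfolding hnull_def by simp
  then obtain U :: "nat \<Rightarrow> nat \<Rightarrow> 'a set" and r where
    U: "\<And>j. S j = (\<Union>i. U j i)"
    and r: "\<And>j i. 0 \<le> r j i \<and> (U j i \<noteq> {} \<longrightarrow> 0 < r j i) \<and>
          (\<forall>x\<in>U j i. \<forall>y\<in>U j i. mdist m x y \<le> r j i)"
    and sum: "\<And>j. (\<Sum>i. ennreal (r j i powr s)) \<le> ennreal (\<epsilon> * (1/2) ^ Suc j)"
    by metis
  have "(\<Sum>j. \<Sum>i. ennreal (r j i powr s)) \<le> (\<Sum>j. ennreal (\<epsilon> * (1/2) ^ Suc j))"
    by (intro suminf_le sum) auto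
  also have "\<dots> = ennreal \<epsilon>"
    by (rule suminf_ennreal_half_powers[OF e])
  finally show "\<exists>U r. (\<Union>j. S j) = (\<Union>i j. U i j) \<and>
    (\<forall>i j. 0 \<le> r i j \<and> (U i j \<noteq> {} \<longrightarrow> 0 < r i j) \<and>
       (\<forall>x\<in>U i j. \<forall>y\<in>U i j. mdist m x y \<le> r i j)) \<and>
    (\<Sum>i. \<Sum>j. ennreal (r i j powr s)) \<le> ennreal \<epsilon>"
    using U r by (intro exI[of _ U] exI[of _ r]) auto
qed

lemma hnull_singleton:
  assumes "s > 0" "mdist m x x = 0"
  shows "hnull m s {x}"
  unfolding hnull_def
proof (intro allI impI)
  fix \<epsilon> :: real assume e: "\<epsilon> > 0"
  let ?U = "\<lambda>i::nat. if i = 0 then {x} else {}"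
  \<comment> \<open>The radius cannot be 0, since the piece is nonempty; this one contributes
    exactly \<epsilon>.\<close>
  let ?r = "\<lambda>i::nat. if i = 0 then \<epsilon> powr (1/s) else 0"
  have "(\<Sum>i. ennreal (?r i powr s)) = (\<Sum>i\<in>{0}. ennreal (?r i powr s))"
    by (rule suminf_finite) auto
  also have "\<dots> = ennreal \<epsilon>"
    using e assms by (simp add: powr_powr)
  finally show "\<exists>U r. {x} = (\<Union>i::nat. U i) \<and>
        (\<forall>i. 0 \<le> r i \<and> (U i \<noteq> {} \<longrightarrow> 0 < r i) \<and> (\<forall>x\<in>U i. \<forall>y\<in>U i. mdist m x y \<le> r i)) \<and>
        (\<Sum>i. ennreal (r i powr s)) \<le> ennreal \<epsilon>"
    using e assms by (intro exI[of _ ?U] exI[of _ ?r]) (auto split: if_splits)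
qed

text \<open>The pieces in \<open>hnull\<close> exhaust \<open>S\<close> exactly and so lie inside
  it; hence a Lipschitz bound on \<open>S\<close> alone suffices. The sum grows by the factor
  \<open>L powr s\<close>.\<close>

lemma hnull_Lipschitz_image:
  assumes S: "hnull m s S" and L: "L > 0"
    and f: "\<And>x y. x \<in> S \<Longrightarrow> y \<in> S \<Longrightarrow> mdist m' (f x) (f y) \<le> L * mdist m x y"
  shows "hnull m' s (f ` S)"
  unfolding hnull_def
proof (intro allI impI)
  fix \<epsilon> :: real assume "\<epsilon> > 0"
  then have "\<epsilon> / L powr s > 0"
    using L by simp
  then obtain U r where U: "S = (\<Union>i::nat. U i)" "\<And>i. 0 \<le> r i"
    "\<And>i. U i \<noteq> {} \<Longrightarrow> 0 < r i" "\<And>i x y. x \<in> U i \<Longrightarrow> y \<in> U i \<Longrightarrow> mdist m x y \<le> r i"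
    and sum: "(\<Sum>i. ennreal (r i powr s)) \<le> ennreal (\<epsilon> / L powr s)"
    by (rule hnullE[OF S]) blast
  have "(\<Sum>i. ennreal ((L * r i) powr s)) = (\<Sum>i. ennreal (L powr s) * ennreal (r i powr s))"
    using L U(2) by (intro suminf_cong) (simp add: powr_mult ennreal_mult)
  also have "\<dots> = ennreal (L powr s) * (\<Sum>i. ennreal (r i powr s))"
    by (rule ennreal_suminf_cmult)
  also have "\<dots> \<le> ennreal (L powr s) * ennreal (\<epsilon> / L powr s)"
    by (intro mult_left_mono sum) auto
  also have "\<dots> = ennreal \<epsilon>"
    using L \<open>\<epsilon> > 0\<close> by (simp flip: ennreal_mult)
  finally have sum': "(\<Sum>i. ennreal ((L * r i) powr s)) \<le> ennreal \<epsilon>" .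
  have dist: "mdist m' (f x) (f y) \<le> L * r i" if "x \<in> U i" "y \<in> U i" for x y i
  proof -
    have "mdist m' (f x) (f y) \<le> L * mdist m x y"
      using that U(1) by (intro f) auto
    also have "\<dots> \<le> L * r i"
      using U(4)[OF that] L by simp
    finally show ?thesis .
  qed
  show "\<exists>U r. f ` S = (\<Union>i::nat. U i) \<and>
        (\<forall>i. 0 \<le> r i \<and> (U i \<noteq> {} \<longrightarrow> 0 < r i) \<and> (\<forall>x\<in>U i. \<forall>y\<in>U i. mdist m' x y \<le> r i)) \<and>
        (\<Sum>i. ennreal (r i powr s)) \<le> ennreal \<epsilon>"
    using L U(1-3) dist sum'
    by (intro exI[of _ "\<lambda>i. f ` U i"] exI[of _ "\<lambda>i. L * r i"]) auto
qed

text \<open>An additional real parameter raises the exponent by at most one. The parameter interval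
  over a piece of radius r is cut into about 2 R / r parts of length r; the images have diameter at
  most 2 L r, and (2 R / r) (2 L r)^(s+1) is a constant times r^s.\<close>

lemma hnull_Lipschitz_image_interval:
  assumes S: "hnull m s S" and s: "s > 0" and L: "L > 0" and R: "R \<ge> 0"
    and f: "\<And>x y a b. x \<in> S \<Longrightarrow> y \<in> S \<Longrightarrow> \<bar>a\<bar> \<le> R \<Longrightarrow> \<bar>b\<bar> \<le> R \<Longrightarrow>
              mdist m' (f x a) (f y b) \<le> L * (mdist m x y + \<bar>a - b\<bar>)"
  shows "hnull m' (s + 1) {f x a | x a. x \<in> S \<and> \<bar>a\<bar> \<le> R}"
proof (rule hnull_doubleI)
  fix \<epsilon> :: real assume e: "\<epsilon> > 0"
  \<comment> \<open>The factor \<open>2 * R + 2\<close> bounds \<open>N i * r i\<close>. That bound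
    needs \<open>r i \<le> 1\<close>, which is enforced by the 1 in the minimum below.\<close>
  define C where "C = (2 * L) powr (s + 1) * (2 * R + 2)"
  have C: "C > 0"
    using L R by (auto simp: C_def intro!: mult_pos_pos)
  have "min 1 (\<epsilon> / C) > 0"
    using C e by simp
  then obtain U r where U: "S = (\<Union>i::nat. U i)" "\<And>i. 0 \<le> r i"
    "\<And>i. U i \<noteq> {} \<Longrightarrow> 0 < r i" "\<And>i x y. x \<in> U i \<Longrightarrow> y \<in> U i \<Longrightarrow> mdist m x y \<le> r i"
    and sum: "(\<Sum>i. ennreal (r i powr s)) \<le> ennreal (min 1 (\<epsilon> / C))"
    by (rule hnullE[OF S]) blast
  have r1: "r i \<le> 1" for i
  proof -
    have "(\<Sum>i\<in>{i}. ennreal (r i powr s)) \<le> (\<Sum>i. ennreal (r i powr s))"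
      by (rule sum_le_suminf) auto
    with sum have "ennreal (r i powr s) \<le> ennreal (min 1 (\<epsilon> / C))"
      by simp
    then have "r i powr s \<le> 1"
      using \<open>min 1 (\<epsilon> / C) > 0\<close> by (simp add: ennreal_le_iff)
    then show ?thesis
      using s gr_one_powr[of "r i" s] by linarith
  qed
  \<comment> \<open>The successor accounts for the right end a = R, whose index is the floor itself.
    If \<open>r i = 0\<close>, division by zero gives \<open>N i = 1\<close>, which is harmless
    because then \<open>U i\<close> is empty.\<close>
  define N where "N i = nat \<lfloor>2 * R / r i\<rfloor> + 1" for i
  have N: "real (N i) \<le> 2 * R / r i + 1" for i
    using R U(2)[of i] by (simp add: N_def)
  define \<rho> where "\<rho> i k = (if k < N i then 2 * L * r i else 0)" for i k
  define A where "A i k = (if k < N i then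
      {f x a | x a. x \<in> U i \<and> \<bar>a\<bar> \<le> R \<and> - R + real k * r i \<le> a \<and> a \<le> - R + (real k + 1) * r i}
      else {})" for i k
  have cover: "{f x a | x a. x \<in> S \<and> \<bar>a\<bar> \<le> R} = (\<Union>i k. A i k)"
  proof (intro equalityI subsetI)
    fix z assume "z \<in> {f x a | x a. x \<in> S \<and> \<bar>a\<bar> \<le> R}"
    then obtain x a i where z: "z = f x a" "x \<in> U i" "\<bar>a\<bar> \<le> R"
      using U(1) by auto
    then have ri: "r i > 0"
      using U(3)[of i] by auto
    define k where "k = nat \<lfloor>(a + R) / r i\<rfloor>"
    have nn: "(a + R) / r i \<ge> 0"
      using z(3) ri by simp
    have k: "real k \<le> (a + R) / r i" "(a + R) / r i \<le> real k + 1"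
      using nn unfolding k_def by linarith+
    have "(a + R) / r i \<le> 2 * R / r i"
      using z(3) ri by (intro divide_right_mono) auto
    then have "k < N i"
      unfolding k_def N_def by (simp add: nat_mono floor_mono le_imp_less_Suc)
    moreover have "- R + real k * r i \<le> a" "a \<le> - R + (real k + 1) * r i"
      using k ri by (auto simp: field_simps)
    ultimately have "z \<in> A i k"
      using z by (auto simp: A_def)
    then show "z \<in> (\<Union>i k. A i k)"
      by blast
  qed (auto simp: A_def U(1) split: if_splits)
  have dist: "mdist m' z z' \<le> \<rho> i k" if zA: "z \<in> A i k" "z' \<in> A i k" for z z' i k
  proof -
    have kN: "k < N i"
      using zA by (auto simp: A_def split: if_splits)
    obtain x a where z: "z = f x a" "x \<in> U i" "\<bar>a\<bar> \<le> R"
        "- R + real k * r i \<le> a" "a \<le> - R + (real k + 1) * r i"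
      using zA(1) unfolding A_def if_P[OF kN] by blast
    obtain x' a' where z': "z' = f x' a'" "x' \<in> U i" "\<bar>a'\<bar> \<le> R"
        "- R + real k * r i \<le> a'" "a' \<le> - R + (real k + 1) * r i"
      using zA(2) unfolding A_def if_P[OF kN] by blast
    have "\<bar>a - a'\<bar> \<le> r i"
      using z(4,5) z'(4,5) by (auto simp: algebra_simps)
    have "mdist m' z z' \<le> L * (mdist m x x' + \<bar>a - a'\<bar>)"
      unfolding z z' using z z' U(1) by (intro f) auto
    also have "\<dots> \<le> L * (r i + r i)"
      using L U(4)[OF z(2) z'(2)] \<open>\<bar>a - a'\<bar> \<le> r i\<close> by (intro mult_left_mono add_mono) auto
    finally show ?thesis
      using kN by (simp add: \<rho>_def)
  qed
  have row: "(\<Sum>k. ennreal (\<rho> i k powr (s + 1))) \<le> ennreal C * ennreal (r i powr s)" for i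
  proof -
    have "(\<Sum>k. ennreal (\<rho> i k powr (s + 1))) = (\<Sum>k<N i. ennreal (\<rho> i k powr (s + 1)))"
      by (rule suminf_finite) (auto simp: \<rho>_def)
    also have "\<dots> = (\<Sum>k<N i. ennreal ((2 * L * r i) powr (s + 1)))"
      by (intro sum.cong) (auto simp: \<rho>_def)
    also have "\<dots> = ennreal (real (N i) * (2 * L * r i) powr (s + 1))"
      by (simp add: ennreal_mult ennreal_of_nat_eq_real_of_nat)
    also have "\<dots> \<le> ennreal (C * r i powr s)"
    proof (rule ennreal_leI)
      show "real (N i) * (2 * L * r i) powr (s + 1) \<le> C * r i powr s"
      proof (cases "r i = 0")
        case True
        then show ?thesis using s by simp
      next
        case False
        with U(2)[of i] have ri: "r i > 0" by simp
        have "real (N i) * r i \<le> (2 * R / r i + 1) * r i"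
          using N[of i] ri by (intro mult_right_mono) auto
        also have "\<dots> \<le> 2 * R + 2"
          using ri r1[of i] by (simp add: field_simps)
        finally have *: "real (N i) * r i \<le> 2 * R + 2" .
        have "real (N i) * (2 * L * r i) powr (s + 1) =
              (2 * L) powr (s + 1) * (real (N i) * r i) * r i powr s"
          using L ri by (simp add: powr_mult powr_add)
        also have "\<dots> \<le> (2 * L) powr (s + 1) * (2 * R + 2) * r i powr s"
          using * by (intro mult_right_mono mult_left_mono) auto
        finally show ?thesis by (simp add: C_def)
      qed
    qed
    finally show ?thesis
      using C by (simp add: ennreal_mult)
  qed
  have "(\<Sum>i. \<Sum>k. ennreal (\<rho> i k powr (s + 1))) \<le> (\<Sum>i. ennreal C * ennreal (r i powr s))"
    by (intro suminf_le row) auto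
  also have "\<dots> = ennreal C * (\<Sum>i. ennreal (r i powr s))"
    by (rule ennreal_suminf_cmult)
  also have "\<dots> \<le> ennreal C * ennreal (\<epsilon> / C)"
    by (intro mult_left_mono order_trans[OF sum] ennreal_leI) auto
  also have "\<dots> = ennreal \<epsilon>"
    using C e by (simp flip: ennreal_mult)
  finally have "(\<Sum>i. \<Sum>k. ennreal (\<rho> i k powr (s + 1))) \<le> ennreal \<epsilon>" .
  moreover have "0 \<le> \<rho> i k \<and> (A i k \<noteq> {} \<longrightarrow> 0 < \<rho> i k)" for i k
    using L U(2,3)[of i] by (cases "U i = {}") (auto simp: \<rho>_def A_def)
  ultimately show "\<exists>V r. {f x a | x a. x \<in> S \<and> \<bar>a\<bar> \<le> R} = (\<Union>i j. V i j) \<and>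
    (\<forall>i j. 0 \<le> r i j \<and> (V i j \<noteq> {} \<longrightarrow> 0 < r i j) \<and>
       (\<forall>x\<in>V i j. \<forall>y\<in>V i j. mdist m' x y \<le> r i j)) \<and>
    (\<Sum>i. \<Sum>j. ennreal (r i j powr (s + 1))) \<le> ennreal \<epsilon>"
    using cover dist by (intro exI[of _ A] exI[of _ \<rho>]) blast
qed

section \<open>Comparison of \<open>hnull\<close> with Hausdorff measure and dimension\<close>

lemma mdiam_le:
  assumes "\<And>x y. x \<in> U \<Longrightarrow> y \<in> U \<Longrightarrow> mdist m x y \<le> r"
  shows "mdiam m U \<le> ennreal r"
  unfolding mdiam_def using assms by (intro SUP_least ennreal_leI) auto

lemma mdist_le_mdiam:
  assumes "x \<in> U" "y \<in> U" "mdiam m U < \<infinity>"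
  shows "mdist m x y \<le> enn2real (mdiam m U)"
proof -
  have "ennreal (mdist m x y) \<le> mdiam m U"
    unfolding mdiam_def using assms(1,2) by (meson SUP_upper2 order_refl)
  then have "enn2real (ennreal (mdist m x y)) \<le> enn2real (mdiam m U)"
    using assms(3) by (intro enn2real_mono) auto
  then show ?thesis
    by (simp add: enn2real_ennreal)
qed

text \<open>A total below \<open>\<delta> powr s\<close> bounds each single term, so every radius is
  at most \<delta>. This is why \<open>hnull\<close> needs no fineness parameter.\<close>

lemma hausdorff_measure_eq_0_if_hnull:
  assumes H: "hnull m s S" and S: "S \<subseteq> mspace m" and s: "s > 0"
  shows "hausdorff_measure m s S = 0"
proof -
  have "hausdorff_premeasure m s \<delta> S \<le> ennreal \<epsilon>" if d: "\<delta> > 0" and e: "\<epsilon> > 0" for \<delta> \<epsilon>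
  proof -
    have "min \<epsilon> (\<delta> powr s) > 0"
      using d e by simp
    then obtain U r where U: "S = (\<Union>i::nat. U i)" "\<And>i. 0 \<le> r i"
      "\<And>i. U i \<noteq> {} \<Longrightarrow> 0 < r i" "\<And>i x y. x \<in> U i \<Longrightarrow> y \<in> U i \<Longrightarrow> mdist m x y \<le> r i"
      and sum: "(\<Sum>i. ennreal (r i powr s)) \<le> ennreal (min \<epsilon> (\<delta> powr s))"
      by (rule hnullE[OF H]) blast
    have "r i \<le> \<delta>" for i
    proof -
      have "(\<Sum>i\<in>{i}. ennreal (r i powr s)) \<le> (\<Sum>i. ennreal (r i powr s))"
        by (rule sum_le_suminf) auto
      with sum have "ennreal (r i powr s) \<le> ennreal (min \<epsilon> (\<delta> powr s))"
        by simp
      then have "r i powr s \<le> \<delta> powr s"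
        using \<open>min \<epsilon> (\<delta> powr s) > 0\<close> by (simp add: ennreal_le_iff)
      then show ?thesis
        using s d U(2)[of i] by (metis not_le powr_less_mono2 less_imp_le)
    qed
    then have diam: "mdiam m (U i) \<le> ennreal \<delta>" for i
      using U(4) by (meson mdiam_le order_trans)
    have "diam_pow m s (U i) \<le> ennreal (r i powr s)" for i
    proof -
      have "enn2real (mdiam m (U i)) \<le> r i"
        using mdiam_le[of "U i" m "r i"] U(4)[of _ i] U(2)[of i] by (intro enn2real_leI) auto
      then show ?thesis
        using s by (auto simp: diam_pow_def intro!: ennreal_leI powr_mono2)
    qed
    then have le: "(\<Sum>i. diam_pow m s (U i)) \<le> (\<Sum>i. ennreal (r i powr s))"
      by (intro suminf_le) auto
    have "hausdorff_premeasure m s \<delta> S \<le> (\<Sum>i. diam_pow m s (U i))"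
      unfolding hausdorff_premeasure_def using U(1) S diam by (intro INF_lower) auto
    also note le
    also note sum
    also have "ennreal (min \<epsilon> (\<delta> powr s)) \<le> ennreal \<epsilon>"
      by (intro ennreal_leI) auto
    finally show ?thesis .
  qed
  then have "hausdorff_premeasure m s \<delta> S = 0" if "\<delta> > 0" for \<delta>
    using that by (metis ennreal_le_epsilon add_0 le_zero_eq zero_le)
  then show ?thesis
    unfolding hausdorff_measure_def by simp
qed

lemma hnull_if_hausdorff_measure_eq_0:
  assumes H: "hausdorff_measure m s S = 0" and s: "s > 0"
  shows "hnull m s S"
  unfolding hnull_def
proof (intro allI impI)
  fix \<epsilon> :: real assume e: "\<epsilon> > 0"
  \<comment> \<open>Diameters and the added margins \<open>p i\<close> contribute \<eta> each, and
    (d + p)^s \<le> 2^s (d^s + p^s) accounts for the factor 2^s.\<close>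
  define \<eta> where "\<eta> = \<epsilon> / (2 * 2 powr s)"
  have \<eta>: "\<eta> > 0"
    using e by (simp add: \<eta>_def)
  \<comment> \<open>The scale 1 is enough. It makes all diameters finite, so that
    \<open>enn2real\<close> does not return its default 0 on them.\<close>
  have "hausdorff_premeasure m s 1 S \<le> 0"
    using H unfolding hausdorff_measure_def by (metis SUP_upper greaterThan_iff zero_less_one)
  then have "hausdorff_premeasure m s 1 S < ennreal \<eta>"
    using \<eta> by (simp add: order_le_less_trans)
  then obtain U where U: "\<And>i::nat. U i \<subseteq> mspace m \<and> mdiam m (U i) \<le> ennreal 1" "S \<subseteq> (\<Union>i. U i)"
    and sum: "(\<Sum>i. diam_pow m s (U i)) < ennreal \<eta>"
    unfolding hausdorff_premeasure_def INF_less_iff by auto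
  define p where "p i = (\<eta> * (1/2) ^ Suc i) powr (1 / s)" for i :: nat
  \<comment> \<open>The margin \<open>p i\<close> makes the radius positive even for a piece of
    diameter 0.\<close>
  define r where "r i = (if U i = {} then 0 else enn2real (mdiam m (U i)) + p i)" for i
  have p: "p i > 0" for i
    using \<eta> by (simp add: p_def)
  have rp: "ennreal (r i powr s) \<le>
      ennreal (2 powr s) * (diam_pow m s (U i) + ennreal (\<eta> * (1/2) ^ Suc i))" for i
  proof (cases "U i = {}")
    case True
    then show ?thesis using s by (simp add: r_def)
  next
    case False
    define d where "d = enn2real (mdiam m (U i))"
    have "d \<ge> 0" by (simp add: d_def)
    have "(d + p i) powr s \<le> (2 * max d (p i)) powr s"
      using \<open>d \<ge> 0\<close> p[of i] s by (intro powr_mono2) auto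
    also have "\<dots> = 2 powr s * max d (p i) powr s"
      using \<open>d \<ge> 0\<close> by (simp add: powr_mult)
    also have "\<dots> \<le> 2 powr s * (d powr s + p i powr s)"
      by (intro mult_left_mono) (auto simp: max_def)
    also have "p i powr s = \<eta> * (1/2) ^ Suc i"
      unfolding p_def using s \<eta> by (simp add: powr_powr)
    finally have "ennreal ((d + p i) powr s) \<le> ennreal (2 powr s * (d powr s + \<eta> * (1/2) ^ Suc i))"
      by (rule ennreal_leI)
    also have "\<dots> = ennreal (2 powr s) * (ennreal (d powr s) + ennreal (\<eta> * (1/2) ^ Suc i))"
      using \<eta> by (simp add: ennreal_mult ennreal_plus)
    finally show ?thesis
      using False s by (simp add: r_def diam_pow_def d_def)
  qed
  have "(\<Sum>i. ennreal (r i powr s)) \<le>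
      (\<Sum>i. ennreal (2 powr s) * (diam_pow m s (U i) + ennreal (\<eta> * (1/2) ^ Suc i)))"
    by (intro suminf_le rp) auto
  also have "\<dots> = ennreal (2 powr s) * ((\<Sum>i. diam_pow m s (U i)) + (\<Sum>i. ennreal (\<eta> * (1/2) ^ Suc i)))"
    by (simp only: ennreal_suminf_cmult suminf_add[OF summableI summableI])
  also have "\<dots> \<le> ennreal (2 powr s) * (ennreal \<eta> + ennreal \<eta>)"
    using sum unfolding suminf_ennreal_half_powers[OF \<eta>]
    by (intro mult_left_mono add_mono) auto
  also have "\<dots> = ennreal (2 powr s * (2 * \<eta>))"
    using \<eta> by (simp flip: ennreal_plus ennreal_mult)
  also have "2 powr s * (2 * \<eta>) = \<epsilon>"
    by (simp add: \<eta>_def)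
  finally have sum': "(\<Sum>i. ennreal (r i powr s)) \<le> ennreal \<epsilon>" .
  have rr: "0 \<le> r i \<and> (U i \<inter> S \<noteq> {} \<longrightarrow> 0 < r i)" for i
    using p[of i] by (auto simp: r_def intro!: add_nonneg_pos add_nonneg_nonneg)
  have dist: "mdist m x y \<le> r i" if "x \<in> U i" "y \<in> U i" for x y i
  proof -
    have "mdist m x y \<le> enn2real (mdiam m (U i))"
      using that U(1)[of i] by (intro mdist_le_mdiam) (auto simp: le_less_trans)
    then show ?thesis
      using that p[of i] by (auto simp: r_def)
  qed
  show "\<exists>U r. S = (\<Union>i::nat. U i) \<and>
        (\<forall>i. 0 \<le> r i \<and> (U i \<noteq> {} \<longrightarrow> 0 < r i) \<and> (\<forall>x\<in>U i. \<forall>y\<in>U i. mdist m x y \<le> r i)) \<and>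
        (\<Sum>i. ennreal (r i powr s)) \<le> ennreal \<epsilon>"
    using U(2) sum' rr dist by (intro exI[of _ "\<lambda>i. U i \<inter> S"] exI[of _ r]) auto
qed

text \<open>At exponent 0 every nonempty piece costs 1, so a cover of cost below 1 has only empty
  pieces. This settles the exponent that the comparison with \<open>hnull\<close> leaves
  out.\<close>

lemma hausdorff_measure_0_eq_0_imp_empty:
  assumes "hausdorff_measure m 0 S = 0"
  shows "S = {}"
proof -
  have "hausdorff_premeasure m 0 1 S \<le> 0"
    using assms unfolding hausdorff_measure_def by (metis SUP_upper greaterThan_iff zero_less_one)
  then have "hausdorff_premeasure m 0 1 S < 1"
    by (simp add: order_le_less_trans)
  then obtain U where U: "S \<subseteq> (\<Union>i::nat. U i)" and sum: "(\<Sum>i. diam_pow m 0 (U i)) < 1"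
    unfolding hausdorff_premeasure_def INF_less_iff by auto
  have "U i = {}" for i
  proof (rule ccontr)
    assume "U i \<noteq> {}"
    then have "1 = (\<Sum>i\<in>{i}. diam_pow m 0 (U i))"
      by (simp add: diam_pow_def)
    also have "\<dots> \<le> (\<Sum>i. diam_pow m 0 (U i))"
      by (rule sum_le_suminf) auto
    finally show False
      using sum by simp
  qed
  then show ?thesis
    using U by simp
qed

lemma hausdorff_dim_le_if_hnull:
  assumes "hnull m s S" "S \<subseteq> mspace m" "s > 0"
  shows "hausdorff_dim m S \<le> ereal s"
  unfolding hausdorff_dim_def using hausdorff_measure_eq_0_if_hnull[OF assms] assms(3)
  by (intro Inf_lower) auto

lemma le_hausdorff_dim_if:
  assumes "S \<noteq> {}" "\<And>s. s > 0 \<Longrightarrow> hnull m s S \<Longrightarrow> d \<le> ereal s"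
  shows "d \<le> hausdorff_dim m S"
  unfolding hausdorff_dim_def
proof (rule Inf_greatest, clarify)
  fix s :: real assume s: "0 \<le> s" "hausdorff_measure m s S = 0"
  then have "s \<noteq> 0"
    using hausdorff_measure_0_eq_0_imp_empty assms(1) by metis
  then show "d \<le> ereal s"
    using s assms(2) hnull_if_hausdorff_measure_eq_0 by (metis less_eq_real_def)
qed

section \<open>Products with balls in subspaces, and linear images\<close>

lemma hnull_Times_box:
  fixes S :: "'a::metric_space set" and D :: "'b::real_normed_vector set"
  assumes "finite D" and S: "hnull euclidean_metric s S" and s: "s > 0" and R: "R \<ge> 0"
  shows "hnull euclidean_metric (s + real (card D))
           (S \<times> {\<Sum>e\<in>D. c e *\<^sub>R e | c. \<forall>e\<in>D. \<bar>c e\<bar> \<le> R})"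
  using assms(1)
proof (induction D rule: finite_induct)
  case empty
  have "hnull euclidean_metric s ((\<lambda>x. (x, 0::'b)) ` S)"
    by (rule hnull_Lipschitz_image[OF S, of 1]) (auto simp: dist_Pair_Pair)
  moreover have "(\<lambda>x. (x, 0::'b)) ` S = S \<times> {0}"
    by auto
  ultimately show ?case
    by simp
next
  case (insert e D)
  let ?box = "\<lambda>D. {\<Sum>e\<in>D. c e *\<^sub>R e | c. \<forall>e\<in>D. \<bar>c e\<bar> \<le> R}"
  \<comment> \<open>Each new vector \<open>e\<close> enters as one interval parameter
    \<open>a\<close>, so the induction adds one to the exponent per vector.\<close>
  let ?f = "\<lambda>(x::'a, p) a. (x, p + a *\<^sub>R e)"
  have lip: "dist (?f z a) (?f z' a') \<le> (1 + norm e) * (dist z z' + \<bar>a - a'\<bar>)" for z z' a a'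
  proof -
    obtain x p x' p' where z: "z = (x, p)" "z' = (x', p')"
      by fastforce
    have "dist (?f z a) (?f z' a') \<le> dist (x, p + a *\<^sub>R e) (x', p' + a *\<^sub>R e) +
        dist (x', p' + a *\<^sub>R e) (x', p' + a' *\<^sub>R e)"
      unfolding z by simp (rule dist_triangle)
    also have "dist (x, p + a *\<^sub>R e) (x', p' + a *\<^sub>R e) = dist z z'"
      by (simp add: z dist_Pair_Pair)
    also have "dist (x', p' + a *\<^sub>R e) (x', p' + a' *\<^sub>R e) = \<bar>a - a'\<bar> * norm e"
      by (simp add: dist_Pair_Pair dist_norm flip: scaleR_left_diff_distrib)
    also have "dist z z' + \<bar>a - a'\<bar> * norm e \<le> (1 + norm e) * (dist z z' + \<bar>a - a'\<bar>)"
      by (simp add: algebra_simps)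
    finally show ?thesis .
  qed
  have "hnull euclidean_metric (s + real (card D) + 1)
      {?f z a | z a. z \<in> S \<times> ?box D \<and> \<bar>a\<bar> \<le> R}"
    by (rule hnull_Lipschitz_image_interval[OF insert.IH, of "1 + norm e"])
      (use s R lip in \<open>auto intro: add_pos_nonneg\<close>)
  moreover have "S \<times> ?box (insert e D) \<subseteq> {?f z a | z a. z \<in> S \<times> ?box D \<and> \<bar>a\<bar> \<le> R}"
  proof
    fix w assume "w \<in> S \<times> ?box (insert e D)"
    then obtain x c where w: "w = (x, \<Sum>e\<in>insert e D. c e *\<^sub>R e)" "x \<in> S"
        "\<forall>e\<in>insert e D. \<bar>c e\<bar> \<le> R"
      by auto
    have "w = ?f (x, \<Sum>e\<in>D. c e *\<^sub>R e) (c e)"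
      using insert.hyps by (simp add: w(1) add.commute)
    moreover have "(x, \<Sum>e\<in>D. c e *\<^sub>R e) \<in> S \<times> ?box D" "\<bar>c e\<bar> \<le> R"
      using w by auto
    ultimately show "w \<in> {?f z a | z a. z \<in> S \<times> ?box D \<and> \<bar>a\<bar> \<le> R}"
      by blast
  qed
  ultimately have "hnull euclidean_metric (s + real (card D) + 1) (S \<times> ?box (insert e D))"
    by (rule hnull_subset)
  then show ?case
    using insert.hyps by (simp add: add_ac)
qed

lemma orthonormal_expansion:
  fixes D :: "'b::euclidean_space set"
  assumes "finite D" "pairwise orthogonal D" "\<And>e. e \<in> D \<Longrightarrow> norm e = 1" "p \<in> span D"
  shows "p = (\<Sum>e\<in>D. (p \<bullet> e) *\<^sub>R e)"
proof -
  obtain c where c: "p = (\<Sum>e\<in>D. c e *\<^sub>R e)"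
    using assms(4) span_finite[OF assms(1)] by auto
  have "p \<bullet> d = c d" if "d \<in> D" for d
  proof -
    have "p \<bullet> d = (\<Sum>e\<in>D. c e * (e \<bullet> d))"
      by (simp add: c inner_sum_left)
    also have "\<dots> = (\<Sum>e\<in>D. if e = d then c e else 0)"
      using assms(2,3) that by (intro sum.cong)
        (auto simp: pairwise_def orthogonal_def norm_eq_1)
    finally show ?thesis
      using assms(1) that by simp
  qed
  then have "(\<Sum>e\<in>D. (p \<bullet> e) *\<^sub>R e) = (\<Sum>e\<in>D. c e *\<^sub>R e)"
    by (intro sum.cong) auto
  with c show ?thesis by simp
qed

text \<open>In an orthonormal basis of \<open>T\<close> the coordinates of a vector are bounded by
  its norm, so the ball lies in a coordinate box with \<open>dim T\<close> sides.\<close>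

lemma hnull_Times_subspace_cball:
  fixes S :: "'a::metric_space set" and T :: "'b::euclidean_space set"
  assumes T: "subspace T" and S: "hnull euclidean_metric s S" and s: "s > 0" and R: "R \<ge> 0"
  shows "hnull euclidean_metric (s + real (dim T)) (S \<times> (T \<inter> cball 0 R))"
proof -
  obtain D where D: "D \<subseteq> T" "pairwise orthogonal D" "\<And>x. x \<in> D \<Longrightarrow> norm x = 1"
      "independent D" "card D = dim T" "span D = T"
    using orthonormal_basis_subspace[OF T] by metis
  have fin: "finite D"
    using D(4) by (rule independent_imp_finite)
  have "hnull euclidean_metric (s + real (card D))
           (S \<times> {\<Sum>e\<in>D. c e *\<^sub>R e | c. \<forall>e\<in>D. \<bar>c e\<bar> \<le> R})"
    using fin S s R by (rule hnull_Times_box)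
  moreover have "T \<inter> cball 0 R \<subseteq> {\<Sum>e\<in>D. c e *\<^sub>R e | c. \<forall>e\<in>D. \<bar>c e\<bar> \<le> R}"
  proof
    fix p assume p: "p \<in> T \<inter> cball 0 R"
    have "\<bar>p \<bullet> e\<bar> \<le> R" if "e \<in> D" for e
      using Cauchy_Schwarz_ineq2[of p e] D(3)[OF that] p by simp
    moreover have "p = (\<Sum>e\<in>D. (p \<bullet> e) *\<^sub>R e)"
      using D p by (intro orthonormal_expansion fin) auto
    ultimately show "p \<in> {\<Sum>e\<in>D. c e *\<^sub>R e | c. \<forall>e\<in>D. \<bar>c e\<bar> \<le> R}"
      by blast
  qed
  ultimately show ?thesis
    using D(5) by (auto elim!: hnull_subset)
qed

lemma dist_scaleR_le:
  fixes p p' :: "'a::real_normed_vector"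
  assumes "norm p \<le> R" "\<bar>t'\<bar> \<le> C"
  shows "dist (t *\<^sub>R p) (t' *\<^sub>R p') \<le> R * dist t t' + C * dist p p'"
proof -
  have "dist (t *\<^sub>R p) (t' *\<^sub>R p') \<le> dist (t *\<^sub>R p) (t' *\<^sub>R p) + dist (t' *\<^sub>R p) (t' *\<^sub>R p')"
    by (rule dist_triangle)
  also have "dist (t *\<^sub>R p) (t' *\<^sub>R p) = norm p * dist t t'"
    by (simp add: dist_norm flip: scaleR_left_diff_distrib)
  also have "dist (t' *\<^sub>R p) (t' *\<^sub>R p') = \<bar>t'\<bar> * dist p p'"
    by (simp add: dist_norm flip: scaleR_right_diff_distrib)
  also have "norm p * dist t t' + \<bar>t'\<bar> * dist p p' \<le> R * dist t t' + C * dist p p'"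
    using assms by (intro add_mono mult_right_mono) auto
  finally show ?thesis .
qed

lemma hnull_linear_image:
  fixes f :: "'a::euclidean_space \<Rightarrow> 'b::real_normed_vector"
  assumes "hnull euclidean_metric s S" "linear f"
  shows "hnull euclidean_metric s (f ` S)"
proof -
  obtain C where C: "C > 0" "\<And>x. norm (f x) \<le> C * norm x"
    using linear_bounded_pos[OF assms(2)] by blast
  show ?thesis
    using C by (intro hnull_Lipschitz_image[OF assms(1), of C])
      (auto simp: dist_norm simp flip: linear_diff[OF assms(2)])
qed

lemma subspace_projection:
  fixes T :: "'a::euclidean_space set"
  assumes "subspace T"
  obtains Q where "linear Q" "\<And>x. Q x \<in> T" "\<And>x. x \<in> T \<Longrightarrow> Q x = x"
proof -
  obtain Q :: "'a \<Rightarrow> 'a" where "range Q \<subseteq> T" "linear Q" "\<forall>v\<in>T. Q (id v) = v"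
    using real_vector.linear_exists_left_inverse_on[OF linear_id assms inj_on_id] by blast
  then show ?thesis
    by (intro that[of Q]) auto
qed

section \<open>Reduction to a cone of directions\<close>

text \<open>The reflection in the hyperplane orthogonal to \<open>v\<close>. For
  \<open>v = 0\<close> division by zero makes it the identity, which is the right value when the two
  unit vectors to be exchanged coincide.\<close>

definition householder :: "'a::real_inner \<Rightarrow> 'a \<Rightarrow> 'a" where
  "householder v x = x - (2 * (v \<bullet> x) / (v \<bullet> v)) *\<^sub>R v"

lemma linear_householder: "linear (householder v)"
  by (rule linearI)
    (simp_all add: householder_def inner_add_right algebra_simps add_divide_distrib)

lemma norm_householder: "norm (householder v x) = norm x"
proof (cases "v = 0")
  case False
  then have "v \<bullet> v \<noteq> 0"
    by simp
  then have "householder v x \<bullet> householder v x = x \<bullet> x"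
    by (simp add: householder_def inner_diff_left inner_diff_right inner_commute field_simps)
  then show ?thesis
    by (simp add: norm_eq)
qed (simp add: householder_def)

lemma dist_householder: "dist (householder v x) (householder v y) = dist x y"
  by (metis dist_norm linear_diff linear_householder norm_householder)

lemma householder_householder: "householder v (householder v x) = x"
proof (cases "v = 0")
  case False
  then have "v \<bullet> v \<noteq> 0"
    by simp
  then show ?thesis
    by (simp add: householder_def inner_diff_right algebra_simps)
qed (simp add: householder_def)

text \<open>The hyperplane orthogonal to u - e is the bisector of two vectors of equal
  length.\<close>

lemma householder_diff:
  assumes "norm u = 1" "norm e = 1"
  shows "householder (u - e) u = e"
proof (cases "u = e")
  case False
  have "(u - e) \<bullet> (u - e) = 2 * ((u - e) \<bullet> u)"
    using assms by (simp add: norm_eq_1 inner_diff_left inner_diff_right inner_commute)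
  moreover have "(u - e) \<bullet> (u - e) \<noteq> 0"
    using False by simp
  ultimately have "2 * ((u - e) \<bullet> u) / ((u - e) \<bullet> (u - e)) = 1"
    using divide_eq_1_iff by metis
  then have "householder (u - e) u = u - 1 *\<^sub>R (u - e)"
    unfolding householder_def by (simp only:)
  then show ?thesis
    by simp
qed (simp add: householder_def)

lemma householder_in_subspace:
  assumes "subspace T" "v \<in> T" "x \<in> T"
  shows "householder v x \<in> T"
  unfolding householder_def using assms by (intro subspace_diff subspace_scale)

text \<open>Inner products with an orthonormal basis transport \<open>T\<close> to the sequence
  model in which the conjecture is stated. The crude constant \<open>N\<close>, from bounding the
  Euclidean norm by the sum of the coordinates, is harmless for null sets.\<close>

lemma subspace_coordinates:
  fixes T :: "'c::euclidean_space set"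
  assumes T: "subspace T" and N: "dim T = N"
  obtains \<Psi> :: "'c \<Rightarrow> nat \<Rightarrow> real" where
    "\<And>z. \<Psi> z \<in> mspace (Rn_metric N)"
    "\<And>a s e i. \<Psi> (a + s *\<^sub>R e) i = \<Psi> a i + s * \<Psi> e i"
    "\<And>x y. mdist (Rn_metric N) (\<Psi> x) (\<Psi> y) \<le> real N * dist x y"
    "\<And>e. e \<in> mspace (Rn_metric N) \<Longrightarrow> \<exists>z\<in>T. \<Psi> z = e"
proof -
  obtain D where D: "D \<subseteq> T" "pairwise orthogonal D" "\<And>x. x \<in> D \<Longrightarrow> norm x = 1"
      "independent D" "card D = dim T" "span D = T"
    using orthonormal_basis_subspace[OF T] by metis
  have fin: "finite D"
    using D(4) by (rule independent_imp_finite)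
  obtain d where "bij_betw d {0..<card D} D"
    using ex_bij_betw_nat_finite[OF fin] by blast
  then have d: "bij_betw d {..<N} D"
    using D(5) N by (simp add: atLeast0LessThan)
  have dD: "d i \<in> D" if "i < N" for i
    using d that by (auto simp: bij_betw_def)
  have orth: "d i \<bullet> d j = (if i = j then 1 else 0)" if "i < N" "j < N" for i j
  proof (cases "i = j")
    case True
    have "d i \<bullet> d i = 1"
      using D(3)[OF dD[OF that(1)]] unfolding norm_eq_1 .
    with True show ?thesis
      by simp
  next
    case False
    then have "d i \<noteq> d j"
      using d that by (auto simp: bij_betw_def inj_on_def)
    then show ?thesis
      using D(2) dD that False by (auto simp: pairwise_def orthogonal_def)
  qed
  define \<Psi> where "\<Psi> z i = (if i < N then z \<bullet> d i else 0)" for z i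
  show ?thesis
  proof
    show "\<Psi> z \<in> mspace (Rn_metric N)" for z
      by (simp add: \<Psi>_def)
    show "\<Psi> (a + s *\<^sub>R e) i = \<Psi> a i + s * \<Psi> e i" for a s e i
      by (simp add: \<Psi>_def inner_add_left)
    show "mdist (Rn_metric N) (\<Psi> x) (\<Psi> y) \<le> real N * dist x y" for x y
    proof -
      have "mdist (Rn_metric N) (\<Psi> x) (\<Psi> y) \<le> (\<Sum>i<N. \<bar>\<Psi> x i - \<Psi> y i\<bar>)"
        unfolding mdist_Rn_metric by (rule L2_set_le_sum_abs)
      also have "\<dots> \<le> (\<Sum>i<N. dist x y)"
      proof (rule sum_mono)
        fix i assume "i \<in> {..<N}"
        then have "\<bar>\<Psi> x i - \<Psi> y i\<bar> = \<bar>(x - y) \<bullet> d i\<bar>" "norm (d i) = 1"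
          using D(3) dD by (auto simp: \<Psi>_def inner_diff_left)
        then show "\<bar>\<Psi> x i - \<Psi> y i\<bar> \<le> dist x y"
          using Cauchy_Schwarz_ineq2[of "x - y" "d i"] by (simp add: dist_norm)
      qed
      finally show ?thesis by simp
    qed
    fix e assume e: "e \<in> mspace (Rn_metric N)"
    have "\<Psi> (\<Sum>i<N. e i *\<^sub>R d i) j = e j" for j
    proof (cases "j < N")
      case True
      have "(\<Sum>i<N. e i *\<^sub>R d i) \<bullet> d j = (\<Sum>i<N. if i = j then e i else 0)"
        unfolding inner_sum_left using orth True by (intro sum.cong) auto
      then show ?thesis
        using True by (simp add: \<Psi>_def)
    qed (use e in \<open>simp add: \<Psi>_def\<close>)
    moreover have "(\<Sum>i<N. e i *\<^sub>R d i) \<in> T"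
      using D(1) dD by (intro subspace_sum[OF T] subspace_scale[OF T]) auto
    ultimately show "\<exists>z\<in>T. \<Psi> z = e"
      by blast
  qed
qed

text \<open>Finitely many reflections of the cone cover all directions, by compactness of the sphere.\<close>

lemma linear_kakeya_conjecture_cone:
  fixes T K :: "'c::euclidean_space set"
  assumes conj: "linear_kakeya_conjecture N" and T: "subspace T" "dim T = N"
    and K: "compact K" "K \<subseteq> T" "hnull euclidean_metric \<sigma> K" and \<sigma>: "\<sigma> > 0"
    and e0: "e0 \<in> T" "norm e0 = 1" and \<epsilon>: "\<epsilon> > 0"
    and seg: "\<And>e. e \<in> T \<Longrightarrow> dist e0 e < \<epsilon> \<Longrightarrow>
                \<exists>a\<in>T. \<exists>l>0. \<forall>s\<in>{0..l}. a + s *\<^sub>R e \<in> K"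
  shows "real N \<le> \<sigma>"
proof -
  obtain \<Psi> :: "'c \<Rightarrow> nat \<Rightarrow> real" where \<Psi>:
    "\<And>z. \<Psi> z \<in> mspace (Rn_metric N)"
    "\<And>a s e i. \<Psi> (a + s *\<^sub>R e) i = \<Psi> a i + s * \<Psi> e i"
    "\<And>x y. mdist (Rn_metric N) (\<Psi> x) (\<Psi> y) \<le> real N * dist x y"
    "\<And>e. e \<in> mspace (Rn_metric N) \<Longrightarrow> \<exists>z\<in>T. \<Psi> z = e"
    using subspace_coordinates[OF T] by blast
  have "compact (T \<inter> sphere 0 1)"
    using closed_subspace[OF T(1)] by (intro closed_Int_compact) auto
  then obtain F where F: "finite F" "F \<subseteq> T \<inter> sphere 0 1" "T \<inter> sphere 0 1 \<subseteq> (\<Union>u\<in>F. ball u \<epsilon>)"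
    using seq_compact_imp_totally_bounded[OF compact_imp_seq_compact[of "T \<inter> sphere 0 1"]] \<epsilon>
    by metis
  have "F \<noteq> {}"
    using F(3) e0 by auto
  define H where "H u = householder (u - e0)" for u
  define K2 where "K2 = (\<Union>u\<in>F. H u ` K)"
  have HT: "H u x \<in> T" if "u \<in> F" "x \<in> T" for u x
    unfolding H_def using T(1) F(2) e0(1) that by (intro householder_in_subspace subspace_diff) auto
  have cont: "continuous_on K (H u)" for u
    unfolding H_def using linear_householder[of "u - e0"]
    by (intro linear_continuous_on) (simp add: linear_conv_bounded_linear)
  have K2: "compact K2"
    unfolding K2_def using F(1) K(1) cont by (intro compact_UN compact_continuous_image) auto
  \<comment> \<open>The finite set \<open>F\<close> is enumerated with repetitions, so that the
    result on countable unions applies.\<close>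
  have "K2 = (\<Union>u\<in>range (from_nat_into F). H u ` K)"
    by (simp only: K2_def range_from_nat_into[OF \<open>F \<noteq> {}\<close> countable_finite[OF F(1)]])
  then have "K2 = (\<Union>j. H (from_nat_into F j) ` K)"
    by (simp only: image_image)
  moreover have "hnull euclidean_metric \<sigma> (H u ` K)" for u
    by (rule hnull_Lipschitz_image[OF K(3), of 1]) (auto simp: H_def dist_householder)
  ultimately have null2: "hnull euclidean_metric \<sigma> K2"
    by (simp only: hnull_UN)
  have null3: "hnull (Rn_metric N) \<sigma> (\<Psi> ` K2)"
  \<comment> \<open>Adding 1 keeps the constant positive when \<open>N = 0\<close>.\<close>
  proof (rule hnull_Lipschitz_image[OF null2, of "real N + 1"])
    fix x y
    have "mdist (Rn_metric N) (\<Psi> x) (\<Psi> y) \<le> real N * dist x y"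
      by (rule \<Psi>(3))
    also have "\<dots> \<le> (real N + 1) * dist x y"
      by (intro mult_right_mono) auto
    finally show "mdist (Rn_metric N) (\<Psi> x) (\<Psi> y) \<le> (real N + 1) * mdist euclidean_metric x y"
      by simp
  qed simp
  have "Lipschitz_continuous_map euclidean_metric (Rn_metric N) \<Psi>"
    unfolding Lipschitz_continuous_map_def using \<Psi>(1,3) by (auto simp del: mdist_Rn_metric)
  then have "continuous_map (mtopology_of euclidean_metric) (mtopology_of (Rn_metric N)) \<Psi>"
    by (rule Lipschitz_continuous_imp_continuous_map)
  then have comp: "compactin (mtopology_of (Rn_metric N)) (\<Psi> ` K2)"
    using K2 by (intro image_compactin[of euclidean]) auto
  have "\<exists>a\<in>mspace (Rn_metric N). \<exists>l>0. \<forall>s\<in>{0..l}. (\<lambda>i. a i + s * e i) \<in> \<Psi> ` K2"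
    if e: "e \<in> mspace (Rn_metric N)" "e \<noteq> (\<lambda>_. 0)" for e
  proof -
    obtain z where z: "z \<in> T" "\<Psi> z = e"
      using \<Psi>(4) e(1) by blast
    have "\<Psi> 0 i = 0" for i
      using \<Psi>(2)[of 0 1 0 i] by simp
    then have "z \<noteq> 0"
      using z e(2) by auto
    define z' where "z' = z /\<^sub>R norm z"
    have z': "z' \<in> T \<inter> sphere 0 1"
      using z \<open>z \<noteq> 0\<close> T(1) by (simp add: z'_def subspace_scale)
    then obtain u where u: "u \<in> F" "dist u z' < \<epsilon>"
      using F(3) by auto
    \<comment> \<open>The isometry \<open>H u\<close> takes \<open>u\<close> to \<open>e0\<close>,
      hence the nearby direction z' into the cone. Being an involution, it also carries the segment
      found there back to direction z'.\<close>
    then have "H u u = e0"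
      unfolding H_def using F(2) e0(2) by (intro householder_diff) auto
    moreover have "dist (H u u) (H u z') < \<epsilon>"
      unfolding H_def dist_householder by (rule u(2))
    ultimately have "dist e0 (H u z') < \<epsilon>"
      by simp
    then obtain a l where a: "a \<in> T" "l > 0" "\<And>s. s \<in> {0..l} \<Longrightarrow> a + s *\<^sub>R H u z' \<in> K"
      using seg[of "H u z'"] HT u(1) z' by blast
    have "(\<lambda>i. \<Psi> (H u a) i + s * e i) \<in> \<Psi> ` K2" if s: "s \<in> {0..l / norm z}" for s
    proof -
      have "s * norm z \<in> {0..l}"
        using s \<open>z \<noteq> 0\<close> by (auto simp: field_simps)
      then have "H u (a + (s * norm z) *\<^sub>R H u z') \<in> K2"
        unfolding K2_def using a(3) u(1) by blast
      moreover have "H u (a + (s * norm z) *\<^sub>R H u z') = H u a + s *\<^sub>R z"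
        using \<open>z \<noteq> 0\<close> unfolding H_def
        by (simp add: linear_add[OF linear_householder] linear_scale[OF linear_householder]
            householder_householder z'_def)
      moreover have "\<Psi> (H u a + s *\<^sub>R z) = (\<lambda>i. \<Psi> (H u a) i + s * e i)"
        using \<Psi>(2) z(2) by auto
      ultimately show ?thesis
        by (auto intro: rev_image_eqI)
    qed
    moreover have "l / norm z > 0"
      using a(2) \<open>z \<noteq> 0\<close> by simp
    ultimately show ?thesis
      using \<Psi>(1) by blast
  qed
  then have "linear_kakeya_set N (\<Psi> ` K2)"
    unfolding linear_kakeya_set_def using comp by blast
  then have "hausdorff_dim (Rn_metric N) (\<Psi> ` K2) = ereal (real N)"
    using conj unfolding linear_kakeya_conjecture_def by blast
  moreover have "hausdorff_dim (Rn_metric N) (\<Psi> ` K2) \<le> ereal \<sigma>"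
    using null3 \<Psi>(1) \<sigma> by (intro hausdorff_dim_le_if_hnull) auto
  ultimately show ?thesis
    by simp
qed

section \<open>The lower bound\<close>

lemma X_mat_kakeya_dim_ge:
  fixes B :: "real^'m^'m::finite"
  assumes conj: "linear_kakeya_conjecture (CARD('m) + 1 + rank (B ** B))" and \<tau>: "\<tau> > 0"
    and Y: "\<And>y. norm y \<le> 1 \<Longrightarrow> y \<in> Y"
    and K: "kakeya_set W {-\<tau>..\<tau>} Y (X_mat B) K"
  shows "ereal (real (CARD('m) + 1) - real (rank B) + real (rank (B ** B)))
           \<le> hausdorff_dim euclidean_metric K"
proof (rule le_hausdorff_dim_if)
  have "0 \<in> Y"
    by (rule Y) simp
  then show "K \<noteq> {}"
    using K \<tau> unfolding kakeya_set_def kakeya_curve_def by fastforce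
next
  fix s :: real assume s: "s > 0" "hnull euclidean_metric s K"
  define T where "T = range ((*v) B)"
  define T2 where "T2 = range ((*v) (B ** B))"
  define T' where "T' = ((UNIV :: (real^'m) set) \<times> T2) \<times> (UNIV :: real set)"
  have T: "subspace T" "dim T = rank B"
    unfolding T_def rank_dim_range by (auto intro!: linear_subspace_image)
  have T2: "subspace T2" "dim T2 = rank (B ** B)"
    unfolding T2_def rank_dim_range by (auto intro!: linear_subspace_image)
  have BT: "(*v) B ` T = T2"
    unfolding T_def T2_def by (auto simp: image_image matrix_vector_mul_assoc)
  have T': "subspace T'" "dim T' = CARD('m) + 1 + rank (B ** B)"
    unfolding T'_def using T2 by (auto simp: subspace_Times eucl.dim_Times)
  \<comment> \<open>The second affine coordinate has velocity in \<open>T2\<close>, but its initial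
    value v - B w is only known to be in \<open>T\<close>. A projection onto \<open>T2\<close>
    corrects the initial value and leaves the velocity unchanged.\<close>
  obtain Q where Q: "linear Q" "\<And>x. Q x \<in> T2" "\<And>x. x \<in> T2 \<Longrightarrow> Q x = x"
    using subspace_projection[OF T2(1)] by blast
  \<comment> \<open>A linear choice of preimages under \<open>B\<close> inside \<open>T\<close>;
    linearity makes the preimage of a small vector small.\<close>
  obtain J where J: "linear J" "\<And>z. J z \<in> T" "\<And>z. z \<in> T2 \<Longrightarrow> B *v J z = z"
  proof -
    have "linear ((*v) B)"
      by simp
    from real_vector.linear_exists_right_inverse_on[OF this T(1)] show ?thesis
      using that BT by blast
  qed
  obtain CJ where CJ: "CJ > 0" "\<And>z. norm (J z) \<le> CJ * norm z"
    using linear_bounded_pos[OF J(1)] by blast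
  have "linear ((*v) B)"
    by simp
  then obtain CB where CB: "CB > 0" "\<And>z. norm (B *v z) \<le> CB * norm z"
    using linear_bounded_pos by blast
  \<comment> \<open>A bound for the norm of v + t B y when \<open>v\<close> and \<open>y\<close>
    have norm at most 1 and t is at most \<tau> in absolute value.\<close>
  define R where "R = 1 + \<tau> * CB"
  have R: "R \<ge> 0"
    using \<tau> CB(1) by (simp add: R_def)
  \<comment> \<open>The straightening map is split in two: \<open>G\<close> contains the product of
    t and p and is Lipschitz only on bounded sets, while \<open>M\<close> is linear.\<close>
  define G :: "((real^'m) \<times> real) \<times> (real^'m) \<Rightarrow> ((real^'m) \<times> (real^'m)) \<times> real"
    where "G = (\<lambda>((x, t), p). ((x - t *\<^sub>R p, p), t))"
  define M :: "((real^'m) \<times> (real^'m)) \<times> real \<Rightarrow> ((real^'m) \<times> (real^'m)) \<times> real"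
    where "M = (\<lambda>((x, p), t). ((x, Q (p - B *v x)), t))"
  define Z where "Z = K \<times> (T \<inter> cball 0 R)"
  define K' where "K' = M ` G ` Z"
  have "linear M"
    unfolding M_def
    by (rule linearI)
      (auto simp: linear_add[OF Q(1)] linear_diff[OF Q(1)] linear_scale[OF Q(1)]
        matrix_vector_right_distrib matrix_vector_mult_scaleR algebra_simps)
  have "compact K"
    using K by (simp add: kakeya_set_def)
  have "compact Z"
    unfolding Z_def using \<open>compact K\<close> closed_subspace[OF T(1)]
    by (intro compact_Times closed_Int_compact) auto
  have "continuous_on Z G"
    unfolding G_def case_prod_unfold by (intro continuous_intros)
  moreover have "continuous_on (G ` Z) M"
    using \<open>linear M\<close> by (intro linear_continuous_on) (simp add: linear_conv_bounded_linear)
  ultimately have "compact K'"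
    unfolding K'_def using \<open>compact Z\<close> by (intro compact_continuous_image)
  obtain C where C: "C > 0" "\<And>z. z \<in> K \<Longrightarrow> norm z \<le> C"
    using compact_imp_bounded[OF \<open>compact K\<close>] unfolding bounded_pos by blast
  have "hnull euclidean_metric (s + real (rank B)) Z"
    unfolding Z_def T(2)[symmetric] using T(1) s R by (intro hnull_Times_subspace_cball) auto
  then have "hnull euclidean_metric (s + real (rank B)) (G ` Z)"
  proof (rule hnull_Lipschitz_image[where L = "3 + R + C"])
    show "3 + R + C > 0"
      using R C(1) by simp
    fix z z' assume z: "z \<in> Z" "z' \<in> Z"
    obtain x t p x' t' p' where z_eq: "z = ((x, t), p)" "z' = ((x', t'), p')"
      by (metis surj_pair)
    have p: "norm p \<le> R"
      using z by (simp add: Z_def z_eq)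
    have "norm (x', t') \<le> C"
      using z by (intro C(2)) (simp add: Z_def z_eq)
    then have t': "\<bar>t'\<bar> \<le> C"
      using norm_snd_le[of t' x'] by simp
    have d: "dist x x' \<le> dist z z'" "dist t t' \<le> dist z z'" "dist p p' \<le> dist z z'"
      using dist_fst_le[of z z'] dist_snd_le[of z z']
        dist_fst_le[of "fst z" "fst z'"] dist_snd_le[of "fst z" "fst z'"]
      by (auto simp: z_eq)
    have "dist (G z) (G z') \<le> (dist (x - t *\<^sub>R p) (x' - t' *\<^sub>R p') + dist p p') + dist t t'"
      unfolding z_eq G_def prod.case dist_Pair_Pair
      by (intro order_trans[OF sqrt_sum_squares_le_sum] add_right_mono) auto
    also have "dist (x - t *\<^sub>R p) (x' - t' *\<^sub>R p') \<le> dist x x' + dist (t *\<^sub>R p) (t' *\<^sub>R p')"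
      using norm_triangle_ineq4[of "x - x'" "t *\<^sub>R p - t' *\<^sub>R p'"]
      by (simp add: dist_norm algebra_simps)
    also have "dist (t *\<^sub>R p) (t' *\<^sub>R p') \<le> R * dist t t' + C * dist p p'"
      using p t' by (rule dist_scaleR_le)
    also have "dist x x' + (R * dist t t' + C * dist p p') + dist p p' + dist t t' \<le>
        dist z z' + (R * dist z z' + C * dist z z') + dist z z' + dist z z'"
      using d R C(1) by (intro add_mono mult_left_mono) auto
    finally show "mdist euclidean_metric (G z) (G z') \<le> (3 + R + C) * mdist euclidean_metric z z'"
      by (simp add: algebra_simps)
  qed
  then have null: "hnull euclidean_metric (s + real (rank B)) K'"
    unfolding K'_def using \<open>linear M\<close> by (rule hnull_linear_image)
  \<comment> \<open>The bound 1/2 keeps the time component above 1/2, so normalising it at most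
    doubles the other components. The second bound then keeps the required \<open>y\<close> in the
    unit ball, hence in \<open>Y\<close>.\<close>
  define \<epsilon> where "\<epsilon> = min (1 / 2) (1 / (2 * (1 + CJ)))"
  have \<epsilon>: "\<epsilon> > 0" "\<epsilon> \<le> 1 / 2" "2 * \<epsilon> * (1 + CJ) \<le> 1"
    using CJ(1) by (auto simp: \<epsilon>_def min_def field_simps)
  have "real (CARD('m) + 1 + rank (B ** B)) \<le> s + real (rank B)"
  proof (rule linear_kakeya_conjecture_cone[OF conj T' \<open>compact K'\<close> _ null, where ?e0.0 = "((0, 0), 1)"])
    show "K' \<subseteq> T'"
      using Q(2) by (auto simp: K'_def M_def T'_def)
    show "s + real (rank B) > 0"
      using s(1) by simp
    show "((0, 0), 1) \<in> T'"
      using subspace_0[OF T2(1)] by (simp add: T'_def)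
    show "norm ((0::real^'m, 0::real^'m), 1::real) = 1"
      by (simp add: norm_Pair)
    show "\<epsilon> > 0"
      by fact
    fix e assume e: "e \<in> T'" "dist ((0, 0), 1) e < \<epsilon>"
    obtain e1 e2 e3 where e_eq: "e = ((e1, e2), e3)"
      by (metis surj_pair)
    have "e2 \<in> T2"
      using e(1) by (simp add: e_eq T'_def)
    have small: "norm e1 < \<epsilon>" "norm e2 < \<epsilon>" "\<bar>e3 - 1\<bar> < \<epsilon>"
      using e(2) dist_fst_le[of "((0, 0), 1)" e] dist_snd_le[of "((0, 0), 1)" e]
        dist_fst_le[of "(0, 0)" "(e1, e2)"] dist_snd_le[of "(0, 0)" "(e1, e2)"]
      by (auto simp: e_eq dist_norm)
    then have e3: "e3 > 1 / 2"
      using \<epsilon>(2) by linarith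
    \<comment> \<open>The curves are parametrised by time, so the direction is rescaled to time
      component 1.\<close>
    define f1 where "f1 = e1 /\<^sub>R e3"
    define f2 where "f2 = e2 /\<^sub>R e3"
    have f_le: "norm f1 \<le> 2 * \<epsilon>" "norm f2 \<le> 2 * \<epsilon>"
    proof -
      have "inverse e3 \<le> 2"
        using e3 by (simp add: field_simps)
      then have "inverse e3 * norm e1 \<le> 2 * \<epsilon>" "inverse e3 * norm e2 \<le> 2 * \<epsilon>"
        using small e3 by (auto intro!: mult_mono)
      then show "norm f1 \<le> 2 * \<epsilon>" "norm f2 \<le> 2 * \<epsilon>"
        using e3 by (auto simp: f1_def f2_def)
    qed
    have "f2 \<in> T2"
      unfolding f2_def using \<open>e2 \<in> T2\<close> T2(1) by (simp add: subspace_scale)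
    define v where "v = J f2"
    have v: "v \<in> T" "B *v v = f2" "norm v \<le> 2 * \<epsilon> * CJ"
    proof -
      show "v \<in> T" "B *v v = f2"
        using J \<open>f2 \<in> T2\<close> by (auto simp: v_def)
      have "norm v \<le> CJ * norm f2"
        unfolding v_def by (rule CJ(2))
      also have "\<dots> \<le> CJ * (2 * \<epsilon>)"
        using f_le(2) CJ(1) by (intro mult_left_mono) auto
      finally show "norm v \<le> 2 * \<epsilon> * CJ"
        by (simp add: mult_ac)
    qed
    \<comment> \<open>The velocities y - v and B v have to be \<open>f1\<close> and
      \<open>f2\<close>. The second equation has fixed \<open>v\<close>, and the first now
      determines \<open>y\<close>.\<close>
    define y where "y = f1 + v"
    have "norm y \<le> 2 * \<epsilon> + 2 * \<epsilon> * CJ"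
      unfolding y_def using f_le(1) v(3) by (rule norm_triangle_mono)
    then have ny: "norm y \<le> 1"
      using \<epsilon>(3) by (simp add: algebra_simps)
    have nv: "norm v \<le> 1"
      using v(3) \<epsilon> by (simp add: algebra_simps)
    obtain w where w: "kakeya_curve {-\<tau>..\<tau>} (X_mat B) y w \<subseteq> K"
      using K Y[OF ny] unfolding kakeya_set_def by blast
    let ?a = "((w, Q (v - B *v w)), 0::real)"
    have line: "?a + t *\<^sub>R ((f1, f2), 1) \<in> K'" if t: "t \<in> {0..\<tau>}" for t
    proof -
      let ?x = "X_mat B w t y"
      let ?p = "v + t *\<^sub>R (B *v y)"
      have "(?x, t) \<in> K"
        using w t \<tau> unfolding kakeya_curve_def by auto
      moreover have "?p \<in> T"
        using v(1) T(1) by (intro subspace_add subspace_scale) (auto simp: T_def)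
      moreover have "norm ?p \<le> R"
      proof -
        have "\<bar>t\<bar> * norm (B *v y) \<le> \<tau> * CB"
          using t order_trans[OF CB(2)[of y] mult_left_mono[OF ny, of CB]] CB(1)
          by (intro mult_mono) auto
        then show ?thesis
          unfolding R_def using nv by (intro norm_triangle_mono) auto
      qed
      ultimately have "M (G ((?x, t), ?p)) \<in> K'"
        unfolding K'_def Z_def by (intro imageI) auto
      moreover have xp: "?x - t *\<^sub>R ?p = w + t *\<^sub>R f1"
        by (simp add: X_mat_def y_def matrix_vector_mult_add_rdistrib scaleR_matrix_vector_assoc[symmetric]
            matrix_vector_right_distrib algebra_simps power2_eq_square)
      moreover have "?p - B *v (w + t *\<^sub>R f1) = (v - B *v w) + t *\<^sub>R f2"
        by (simp add: y_def matrix_vector_right_distrib matrix_vector_mult_scaleR v(2) algebra_simps)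
      moreover have "Q ((v - B *v w) + t *\<^sub>R f2) = Q (v - B *v w) + t *\<^sub>R f2"
        using Q(3)[OF \<open>f2 \<in> T2\<close>] by (simp add: linear_add[OF Q(1)] linear_scale[OF Q(1)])
      ultimately show ?thesis
        by (simp add: G_def M_def)
    qed
    have "?a \<in> T'"
      using Q(2) by (simp add: T'_def)
    moreover have "\<forall>r\<in>{0..\<tau> / e3}. ?a + r *\<^sub>R e \<in> K'"
    proof
      fix r assume "r \<in> {0..\<tau> / e3}"
      then have "r * e3 \<in> {0..\<tau>}"
        using e3 by (auto simp: field_simps)
      then have "?a + (r * e3) *\<^sub>R ((f1, f2), 1) \<in> K'"
        by (rule line)
      moreover have "(r * e3) *\<^sub>R ((f1, f2), 1) = r *\<^sub>R e"
        using e3 by (simp add: e_eq f1_def f2_def)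
      ultimately show "?a + r *\<^sub>R e \<in> K'"
        by (simp only:)
    qed
    moreover have "\<tau> / e3 > 0"
      using \<tau> e3 by simp
    ultimately show "\<exists>a\<in>T'. \<exists>l>0. \<forall>s\<in>{0..l}. a + s *\<^sub>R e \<in> K'"
      by blast
  qed
  then show "ereal (real (CARD('m) + 1) - real (rank B) + real (rank (B ** B))) \<le> ereal s"
    by simp
qed

section \<open>The variety\<close>

lemma X_mat_eq: "X_mat B w t y = w + t *\<^sub>R y + t\<^sup>2 *\<^sub>R (B *v y)"
  by (simp add: X_mat_def matrix_vector_mult_add_rdistrib scaleR_matrix_vector_assoc[symmetric])

text \<open>For \<open>\<eta>\<close> in the following space, \<open>B\<^sup>T\<eta>\<close> (written \<open>\<eta> v* B\<close>) is orthogonal to the range of \<open>B\<close>,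
  so \<open>B\<^sup>T\<eta> \<bullet> x\<close> has no quadratic term in \<open>t\<close> along a curve, and \<open>\<eta> \<bullet> x = t (B\<^sup>T\<eta> \<bullet> x)\<close> holds as soon as
  \<open>\<eta> \<bullet> w = 0\<close> and \<open>B\<^sup>T\<eta> \<bullet> w = \<eta> \<bullet> y\<close>.\<close>

definition defect_space :: "real^'m^'m::finite \<Rightarrow> (real^'m) set" where
  "defect_space B = {\<eta> \<in> range ((*v) B). \<forall>x \<in> range ((*v) (B ** B)). orthogonal x \<eta>}"

lemma subspace_defect_space: "subspace (defect_space B)"
proof -
  have 1: "subspace (range ((*v) B))"
    by (auto intro!: linear_subspace_image)
  show ?thesis
    using 1 unfolding defect_space_def subspace_def
    by (auto simp: orthogonal_clauses)
qed

text \<open>The range of B^2 lies in the range of \<open>B\<close>, and the defect space is its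
  orthogonal complement there. Its dimension is the codimension of the variety.\<close>

lemma dim_defect_space: "dim (defect_space B) + rank (B ** B) = rank B"
proof -
  have "subspace (range ((*v) B))" "subspace (range ((*v) (B ** B)))"
    by (auto intro!: linear_subspace_image)
  moreover have "range ((*v) (B ** B)) \<subseteq> range ((*v) B)"
    by (auto simp flip: matrix_vector_mul_assoc)
  ultimately show ?thesis
    unfolding defect_space_def rank_dim_range
    using dim_subspace_orthogonal_to_vectors by blast
qed

lemma defect_space_inner_square:
  assumes "\<eta> \<in> defect_space B"
  shows "\<eta> \<bullet> (B *v (B *v y)) = 0"
  using assms unfolding defect_space_def orthogonal_def
  by (auto simp: matrix_vector_mul_assoc inner_commute)

text \<open>Moving \<open>B\<close> to the other factor turns \<eta>' = B u into B^2 u, which is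
  orthogonal to \<eta>.\<close>

lemma defect_space_inner_transpose:
  assumes "\<eta> \<in> defect_space B" "\<eta>' \<in> defect_space B"
  shows "(\<eta> v* B) \<bullet> \<eta>' = 0"
proof -
  obtain u where "\<eta>' = B *v u"
    using assms(2) by (auto simp: defect_space_def)
  then show ?thesis
    using assms(1) by (simp add: dot_lmul_matrix defect_space_inner_square)
qed

text \<open>The kernel of B^T is orthogonal to the range of \<open>B\<close>, and \<eta> belongs to
  that range.\<close>

lemma defect_space_transpose_eq_0:
  assumes "\<eta> \<in> defect_space B" "\<eta> v* B = 0"
  shows "\<eta> = 0"
proof -
  obtain u where "\<eta> = B *v u"
    using assms(1) by (auto simp: defect_space_def)
  then have "\<eta> \<bullet> \<eta> = (\<eta> v* B) \<bullet> u"
    by (simp add: dot_lmul_matrix)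
  then show ?thesis
    using assms(2) by simp
qed

text \<open>The inner products of A y with the defect space E and with its image B^T E are
  prescribed. They do not conflict, since the two spaces are orthogonal and B^T is injective on E:
  (\<eta>, \<eta>') can be recovered linearly from \<eta> + B^T \<eta>'. The adjoint of the recovery
  of \<eta>' is a solution, and its linearity provides continuity in \<open>y\<close>.\<close>

lemma defect_space_position:
  obtains A where "linear A" "\<And>\<eta> y. \<eta> \<in> defect_space B \<Longrightarrow> \<eta> \<bullet> A y = 0"
    "\<And>\<eta> y. \<eta> \<in> defect_space B \<Longrightarrow> (\<eta> v* B) \<bullet> A y = \<eta> \<bullet> y"
proof -
  let ?E = "defect_space B"
  let ?f = "\<lambda>(\<eta>, \<eta>'). \<eta> + \<eta>' v* B"
  note E = subspace_defect_space[of B]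
  have lin: "linear ?f"
    by (rule linearI) (auto simp: vector_matrix_left_distrib scaleR_vector_matrix_assoc algebra_simps)
  have inj: "inj_on ?f (?E \<times> ?E)"
  proof (rule inj_onI)
    fix p q assume pq: "p \<in> ?E \<times> ?E" "q \<in> ?E \<times> ?E" "?f p = ?f q"
    obtain d d' where d: "p - q = (d, d')"
      by fastforce
    have dE: "d \<in> ?E" "d' \<in> ?E"
      using subspace_diff[OF subspace_Times[OF E E] pq(1,2)] d by auto
    have "?f (p - q) = 0"
      using linear_diff[OF lin, of p q] pq(3) by simp
    then have sum: "d + d' v* B = 0"
      by (simp add: d)
    then have "d \<bullet> d + (d' v* B) \<bullet> d = 0"
      by (metis inner_add_left inner_zero_left)
    then have "d = 0"
      using defect_space_inner_transpose[OF dE(2,1)] by simp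
    then have "d' = 0"
      using sum defect_space_transpose_eq_0[OF dE(2)] by simp
    then show "p = q"
      using d \<open>d = 0\<close> by (simp add: zero_prod_def[symmetric])
  qed
  obtain g where g: "linear g" "\<And>v. v \<in> ?E \<times> ?E \<Longrightarrow> g (?f v) = v"
    using real_vector.linear_exists_left_inverse_on[OF lin subspace_Times[OF E E] inj] by blast
  have sg: "linear (snd \<circ> g)"
    using g(1) by (intro linear_compose linear_snd)
  have zero: "0 \<in> ?E"
    by (rule subspace_0[OF E])
  show ?thesis
  proof
    show "linear (adjoint (snd \<circ> g))"
      by (rule adjoint_linear[OF sg])
    fix \<eta> y assume \<eta>: "\<eta> \<in> ?E"
    show "\<eta> \<bullet> adjoint (snd \<circ> g) y = 0"
      using g(2)[of "(\<eta>, 0)"] \<eta> zero by (simp add: adjoint_works[OF sg])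
    show "(\<eta> v* B) \<bullet> adjoint (snd \<circ> g) y = \<eta> \<bullet> y"
      using g(2)[of "(0, \<eta>)"] \<eta> zero by (simp add: adjoint_works[OF sg])
  qed
qed

section \<open>Equations, gradients and smoothness of the variety\<close>

definition defect_poly :: "real^'m^'m::finite \<Rightarrow> real^'m \<Rightarrow> (real^'m) \<times> real \<Rightarrow> real" where
  "defect_poly B \<eta> z = \<eta> \<bullet> fst z - snd z * ((\<eta> v* B) \<bullet> fst z)"

definition defect_variety :: "real^'m^'m::finite \<Rightarrow> ((real^'m) \<times> real) set" where
  "defect_variety B = {z. \<forall>\<eta>\<in>defect_space B. defect_poly B \<eta> z = 0}"

lemma linear_defect_poly: "linear (\<lambda>\<eta>. defect_poly B \<eta> z)"
  by (rule linearI)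
    (simp_all add: defect_poly_def vector_matrix_left_distrib scaleR_vector_matrix_assoc
      inner_add_left algebra_simps)

lemma real_polynomial_function_defect_poly: "real_polynomial_function (defect_poly B \<eta>)"
proof -
  have "real_polynomial_function (\<lambda>z::(real^'a) \<times> real. a \<bullet> fst z)" for a
    by (intro real_polynomial_function.intros(1) bounded_linear_compose[OF bounded_linear_inner_right] bounded_linear_fst)
  moreover have "real_polynomial_function (snd :: (real^'a) \<times> real \<Rightarrow> real)"
    by (intro real_polynomial_function.intros(1) bounded_linear_snd)
  ultimately show ?thesis
    unfolding defect_poly_def by (intro real_polynomial_function_diff real_polynomial_function.intros(4))
qed

definition defect_grad :: "real^'m^'m::finite \<Rightarrow> (real^'m) \<times> real \<Rightarrow> real^'m \<Rightarrow> (real^'m) \<times> real" where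
  "defect_grad B z \<eta> = (\<eta> - snd z *\<^sub>R (\<eta> v* B), - ((\<eta> v* B) \<bullet> fst z))"

lemma GDERIV_defect_poly: "GDERIV (defect_poly B \<eta>) z :> defect_grad B z \<eta>"
  unfolding gderiv_def defect_poly_def defect_grad_def
  by (auto intro!: derivative_eq_intros
      simp: inner_prod_def inner_diff_left inner_diff_right inner_commute algebra_simps)

lemma linear_defect_grad: "linear (defect_grad B z)"
  by (rule linearI)
    (simp_all add: defect_grad_def vector_matrix_left_distrib scaleR_vector_matrix_assoc
      inner_add_left algebra_simps)

text \<open>If the gradient belonging to d vanishes, its spatial part gives d = t B^T d; but B^T d
  is orthogonal to d, so d = 0. No equation of the variety is used, so this holds at every point of
  space.\<close>

lemma inj_on_defect_grad: "inj_on (defect_grad B z) (defect_space B)"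
proof (rule inj_onI)
  fix a b assume ab: "a \<in> defect_space B" "b \<in> defect_space B" "defect_grad B z a = defect_grad B z b"
  define d where "d = a - b"
  have d: "d \<in> defect_space B"
    unfolding d_def using ab subspace_defect_space by (intro subspace_diff)
  have "defect_grad B z d = 0"
    unfolding d_def using ab(3) by (simp add: linear_diff[OF linear_defect_grad])
  then have "d = snd z *\<^sub>R (d v* B)"
    by (simp add: defect_grad_def zero_prod_def)
  then have "d \<bullet> d = snd z * ((d v* B) \<bullet> d)"
    by (metis inner_scaleR_left)
  then show "a = b"
    using defect_space_inner_transpose[OF d d] by (simp add: d_def)
qed

text \<open>A basis of the defect space supplies global equations with everywhere independent
  gradients, so the whole space serves as neighbourhood of each point.\<close>

lemma smooth_variety_defect_variety:
  fixes B :: "real^'m^'m::finite"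
  shows "smooth_variety (CARD('m) + 1 - rank B + rank (B ** B)) (defect_variety B)"
proof -
  obtain D where D: "D \<subseteq> defect_space B" "independent D" "card D = dim (defect_space B)"
      "span D = defect_space B"
    using orthonormal_basis_subspace[OF subspace_defect_space] by metis
  have fin: "finite D"
    using D(2) by (rule independent_imp_finite)
  define Q where "Q = defect_poly B ` D"
  have V: "defect_variety B = {z. \<forall>q\<in>Q. q z = 0}"
  proof (intro equalityI subsetI)
    fix z assume z: "z \<in> {z. \<forall>q\<in>Q. q z = 0}"
    have "defect_poly B \<eta> z = 0" if "\<eta> \<in> defect_space B" for \<eta>
    proof (rule linear_eq_0_on_span[OF linear_defect_poly])
      show "\<eta> \<in> span D"
        using that D(4) by simp
    qed (use z in \<open>simp add: Q_def\<close>)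
    then show "z \<in> defect_variety B"
      by (auto simp: defect_variety_def)
  qed (use D(1) in \<open>auto simp: defect_variety_def Q_def\<close>)
  \<comment> \<open>\<open>Q\<close> is a set of functions, so its cardinality is that of
    \<open>D\<close> only if different \<eta> give different polynomials. Evaluation at time 0
    separates them.\<close>
  have inj: "inj_on (defect_poly B) D"
  proof (rule inj_onI)
    fix a b assume "defect_poly B a = defect_poly B b"
    then have "defect_poly B a (a - b, 0) = defect_poly B b (a - b, 0)"
      by simp
    then have "(a - b) \<bullet> (a - b) = 0"
      by (simp add: defect_poly_def inner_diff_left)
    then show "a = b"
      by simp
  qed
  have "rank B \<le> CARD('m)"
    using rank_bound[of B] by simp
  then have card: "card Q + (CARD('m) + 1 - rank B + rank (B ** B)) = DIM((real^'m) \<times> real)"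
    using D(3) dim_defect_space[of B] by (simp add: Q_def card_image[OF inj])
  have "0 \<in> defect_variety B"
    by (simp add: defect_variety_def defect_poly_def)
  have grad: "(\<forall>q\<in>Q. GDERIV q z :> g q) \<and> inj_on g Q \<and> independent (g ` Q)"
    \<comment> \<open>The definition of a smooth variety indexes gradients by the polynomials
      themselves, hence the inverse of \<eta> \<mapsto> \<open>defect_poly B \<eta>\<close>.\<close>
    if g: "g = defect_grad B z \<circ> the_inv_into D (defect_poly B)" for g z
  proof -
    have gq: "g (defect_poly B \<eta>) = defect_grad B z \<eta>" if "\<eta> \<in> D" for \<eta>
      using that by (simp add: g the_inv_into_f_f[OF inj])
    have "inj_on (defect_grad B z) D"
      using inj_on_defect_grad D(1) by (rule inj_on_subset)
    then have "inj_on g Q"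
      unfolding Q_def using gq by (auto simp: inj_on_def)
    moreover have "g ` Q = defect_grad B z ` D"
      unfolding Q_def image_image using gq by (intro image_cong) auto
    moreover have "independent (defect_grad B z ` D)"
      by (rule linear_independent_injective_image[OF linear_defect_grad D(2)])
        (simp add: D(4) inj_on_defect_grad)
    ultimately show ?thesis
      using gq by (auto simp: Q_def intro!: GDERIV_defect_poly)
  qed
  show ?thesis
    unfolding smooth_variety_def
  proof (intro conjI ballI)
    show "real_algebraic_set (defect_variety B)"
      unfolding real_algebraic_set_def V using fin real_polynomial_function_defect_poly
      by (intro exI[of _ Q]) (auto simp: Q_def)
    show "defect_variety B \<noteq> {}"
      using \<open>0 \<in> defect_variety B\<close> by blast
    fix z assume "z \<in> defect_variety B"
    have "Q \<subseteq> vanishing_ideal (defect_variety B)"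
      unfolding vanishing_ideal_def using V real_polynomial_function_defect_poly by (auto simp: Q_def)
    moreover have "finite Q"
      using fin by (simp add: Q_def)
    moreover have "defect_variety B \<inter> UNIV = {z \<in> UNIV. \<forall>q\<in>Q. q z = 0}"
      using V by simp
    ultimately show "\<exists>Q g U. finite Q \<and> Q \<subseteq> vanishing_ideal (defect_variety B) \<and>
        card Q + (CARD('m) + 1 - rank B + rank (B ** B)) = DIM((real^'m) \<times> real) \<and>
        (\<forall>q\<in>Q. GDERIV q z :> g q) \<and> inj_on g Q \<and> independent (g ` Q) \<and>
        open U \<and> z \<in> U \<and> defect_variety B \<inter> U = {z\<in>U. \<forall>q\<in>Q. q z = 0}"
      using card grad[OF refl, of z]
      by (intro exI[of _ Q] exI[of _ "defect_grad B z \<circ> the_inv_into D (defect_poly B)"]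
          exI[of _ UNIV] conjI) auto
  qed
qed

text \<open>The variety is a graph over the orthogonal complement of the defect space, times the time axis:
  if \<open>x = z + e\<close> with \<open>e\<close> the projection of \<open>x\<close> to the defect space, the equations say that \<open>e\<close> is
  \<open>t\<close> times the projection of \<open>B z\<close>.\<close>

lemma hausdorff_dim_bounded_subset_defect_variety:
  fixes B :: "real^'m^'m::finite"
  assumes "bounded K" "K \<subseteq> defect_variety B"
  shows "hausdorff_dim euclidean_metric K \<le> ereal (real (CARD('m) + 1 - rank B + rank (B ** B)))"
proof -
  let ?E = "defect_space B"
  obtain D where D: "D \<subseteq> ?E" "pairwise orthogonal D" "\<And>x. x \<in> D \<Longrightarrow> norm x = 1"
      "independent D" "span D = ?E"
    using orthonormal_basis_subspace[OF subspace_defect_space] by metis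
  have fin: "finite D"
    using D(4) by (rule independent_imp_finite)
  define P where "P x = (\<Sum>\<eta>\<in>D. (x \<bullet> \<eta>) *\<^sub>R \<eta>)" for x
  have linP: "linear P"
    by (rule linearI)
      (simp_all add: P_def inner_add_left scaleR_add_left sum.distrib scaleR_sum_right)
  have PE: "P x \<in> ?E" for x
    unfolding P_def using D(1) subspace_defect_space
    by (intro subspace_sum subspace_scale) auto
  have Pinner: "P x \<bullet> \<eta> = x \<bullet> \<eta>" if "\<eta> \<in> D" for x \<eta>
  proof -
    have "P x \<bullet> \<eta> = (\<Sum>e\<in>D. if e = \<eta> then x \<bullet> e else 0)"
      unfolding P_def inner_sum_left using D(2,3) that
      by (intro sum.cong) (auto simp: pairwise_def orthogonal_def norm_eq_1)
    then show ?thesis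
      using fin that by simp
  qed
  have Pperp: "(x - P x) \<bullet> \<eta> = 0" if "\<eta> \<in> ?E" for x \<eta>
  proof -
    have "linear (\<lambda>\<eta>. (x - P x) \<bullet> \<eta>)"
      by (simp add: bounded_linear.linear bounded_linear_inner_right)
    moreover have "(x - P x) \<bullet> \<eta> = 0" if "\<eta> \<in> D" for \<eta>
      using Pinner[OF that, of x] by (simp add: inner_diff_left)
    moreover have "\<eta> \<in> span D"
      using that D(5) by simp
    ultimately show ?thesis
      by (rule linear_eq_0_on_span)
  qed
  define L where "L = P \<circ> (*v) B"
  have linL: "linear L"
    unfolding L_def using linP by (intro linear_compose) simp
  obtain CP where CP: "CP > 0" "\<And>x. norm (P x) \<le> CP * norm x"
    using linear_bounded_pos[OF linP] by blast
  obtain CL where CL: "CL > 0" "\<And>x. norm (L x) \<le> CL * norm x"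
    using linear_bounded_pos[OF linL] by blast
  obtain R0 where R0: "R0 > 0" "\<And>z. z \<in> K \<Longrightarrow> norm z \<le> R0"
    using assms(1) unfolding bounded_pos by blast
  \<comment> \<open>The three terms bound the norms of x, of its projection P x and of t.\<close>
  define R where "R = R0 + CP * R0 + R0"
  have R: "R > 0"
    using R0 CP(1) by (simp add: R_def add_pos_pos)
  define Ep where "Ep = {y \<in> (UNIV :: (real^'m) set). \<forall>x\<in>?E. orthogonal x y}"
  have Ep: "subspace Ep"
    unfolding Ep_def subspace_def by (auto simp: orthogonal_clauses)
  have "dim Ep + dim ?E = CARD('m)"
    unfolding Ep_def using dim_subspace_orthogonal_to_vectors[OF subspace_defect_space[of B] subspace_UNIV]
    by simp
  then have dimEp: "dim (Ep \<times> (UNIV :: real set)) = CARD('m) + 1 - rank B + rank (B ** B)"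
    using dim_defect_space[of B] rank_bound[of B] Ep by (simp add: eucl.dim_Times)
  define \<phi> where "\<phi> = (\<lambda>(z, t::real). (z + t *\<^sub>R L z, t))"
  have graph: "K \<subseteq> \<phi> ` ((Ep \<times> UNIV) \<inter> cball 0 R)"
  proof
    fix p assume "p \<in> K"
    obtain x t where p: "p = (x, t)"
      by fastforce
    have xt: "norm x \<le> R0" "\<bar>t\<bar> \<le> R0"
      using R0(2)[OF \<open>p \<in> K\<close>] norm_fst_le[of x t] norm_snd_le[of t x] by (auto simp: p)
    define z where "z = x - P x"
    have "x \<bullet> \<eta> = t * ((B *v z) \<bullet> \<eta>)" if \<eta>: "\<eta> \<in> D" for \<eta>
    proof -
      have "\<eta> \<in> ?E"
        using \<eta> D(1) by blast
      then have "x \<bullet> \<eta> = t * ((\<eta> v* B) \<bullet> x)"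
        using \<open>p \<in> K\<close> assms(2) by (auto simp: p defect_variety_def defect_poly_def inner_commute)
      \<comment> \<open>The component P x drops out by orthogonality, so the right-hand side
        involves \<open>z\<close> alone and the equation can be solved for P x.\<close>
      also have "(\<eta> v* B) \<bullet> x = (\<eta> v* B) \<bullet> z"
        using defect_space_inner_transpose[OF \<open>\<eta> \<in> ?E\<close> PE[of x]] by (simp add: z_def inner_diff_right)
      also have "\<dots> = (B *v z) \<bullet> \<eta>"
        unfolding dot_lmul_matrix by (rule inner_commute)
      finally show ?thesis .
    qed
    then have "P x = (\<Sum>\<eta>\<in>D. t *\<^sub>R ((B *v z) \<bullet> \<eta>) *\<^sub>R \<eta>)"
      unfolding P_def by (intro sum.cong) auto
    also have "\<dots> = t *\<^sub>R L z"
      by (simp only: L_def P_def scaleR_sum_right o_def)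
    finally have "P x = t *\<^sub>R L z" .
    then have "p = \<phi> (z, t)"
      by (simp add: \<phi>_def p z_def)
    moreover have "z \<in> Ep"
      unfolding Ep_def z_def orthogonal_def using Pperp by (simp add: inner_commute)
    moreover have "norm (z, t) \<le> R"
    proof -
      have "norm (z, t) \<le> norm z + norm t"
        by (rule norm_Pair_le)
      also have "norm z \<le> norm x + norm (P x)"
        unfolding z_def by (rule norm_triangle_ineq4)
      also have "norm (P x) \<le> CP * R0"
        using CP(2)[of x] mult_left_mono[OF xt(1), of CP] CP(1) by linarith
      finally show ?thesis
        using xt by (simp add: R_def)
    qed
    ultimately show "p \<in> \<phi> ` ((Ep \<times> UNIV) \<inter> cball 0 R)"
      by (intro image_eqI[of _ \<phi> "(z, t)"]) (simp_all add: mem_Times_iff)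
  qed
  \<comment> \<open>The product lemma starts from a positive exponent. A point is null for every s >
    0, so multiplying it by the ball costs an extra s, which then tends to 0.\<close>
  have "hausdorff_dim euclidean_metric K \<le>
      ereal (real (CARD('m) + 1 - rank B + rank (B ** B))) + ereal s" if s: "s > 0" for s
  proof -
    let ?d = "s + real (CARD('m) + 1 - rank B + rank (B ** B))"
    have "hnull euclidean_metric s {0::real}"
      by (rule hnull_singleton) (use s in auto)
    then have "hnull euclidean_metric (s + real (dim (Ep \<times> (UNIV :: real set))))
        ({0::real} \<times> ((Ep \<times> (UNIV :: real set)) \<inter> cball 0 R))"
      using subspace_Times[OF Ep subspace_UNIV] s R by (intro hnull_Times_subspace_cball) simp_all
    then have "hnull euclidean_metric ?d ({0::real} \<times> ((Ep \<times> (UNIV :: real set)) \<inter> cball 0 R))"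
      by (simp only: dimEp)
    from hnull_linear_image[OF this linear_snd]
    have "hnull euclidean_metric ?d ((Ep \<times> (UNIV :: real set)) \<inter> cball 0 R)"
      unfolding snd_image_times by (simp only: insert_not_empty if_False)
    then have "hnull euclidean_metric ?d (\<phi> ` ((Ep \<times> UNIV) \<inter> cball 0 R))"
    proof (rule hnull_Lipschitz_image[where L = "2 + CL * R + R * CL"])
      show "2 + CL * R + R * CL > 0"
        using CL(1) R by (simp add: add_pos_pos)
      fix p q assume pq: "p \<in> (Ep \<times> (UNIV :: real set)) \<inter> cball 0 R"
        "q \<in> (Ep \<times> (UNIV :: real set)) \<inter> cball 0 R"
      obtain z t z' t' where eq: "p = (z, t)" "q = (z', t')"
        by fastforce
      have "norm (z, t) \<le> R" "norm (z', t') \<le> R"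
        using pq by (simp_all add: eq)
      then have "norm z \<le> R" "\<bar>t'\<bar> \<le> R"
        using norm_fst_le[of z t] norm_snd_le[of t' z'] by simp_all
      then have Lz: "norm (L z) \<le> CL * R"
        using CL(2)[of z] mult_left_mono[of "norm z" R CL] CL(1) by linarith
      have LL: "dist (L z) (L z') \<le> CL * dist z z'"
        unfolding dist_norm using CL(2)[of "z - z'"] by (simp add: linear_diff[OF linL])
      have d: "dist z z' \<le> dist p q" "dist t t' \<le> dist p q"
        using dist_fst_le[of p q] dist_snd_le[of p q] by (simp_all add: eq)
      have "dist (\<phi> p) (\<phi> q) \<le> dist (z + t *\<^sub>R L z) (z' + t' *\<^sub>R L z') + dist t t'"
        unfolding eq \<phi>_def prod.case dist_Pair_Pair by (rule sqrt_sum_squares_le_sum) auto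
      also have "dist (z + t *\<^sub>R L z) (z' + t' *\<^sub>R L z') \<le> dist z z' + dist (t *\<^sub>R L z) (t' *\<^sub>R L z')"
        by (rule dist_triangle_add)
      also have "dist (t *\<^sub>R L z) (t' *\<^sub>R L z') \<le> (CL * R) * dist p q + R * (CL * dist p q)"
      proof -
        have "dist (t *\<^sub>R L z) (t' *\<^sub>R L z') \<le> (CL * R) * dist t t' + R * dist (L z) (L z')"
          using Lz \<open>\<bar>t'\<bar> \<le> R\<close> by (rule dist_scaleR_le)
        moreover have "dist (L z) (L z') \<le> CL * dist p q"
          using order_trans[OF LL mult_left_mono[OF d(1)]] CL(1) by simp
        moreover have "(CL * R) * dist t t' \<le> (CL * R) * dist p q"
          using d(2) CL(1) R by (intro mult_left_mono) auto
        moreover have "R * dist (L z) (L z') \<le> R * (CL * dist p q)"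
          using calculation(2) R by (intro mult_left_mono) auto
        ultimately show ?thesis
          by linarith
      qed
      also note d(1)
      also note d(2)
      finally show "mdist euclidean_metric (\<phi> p) (\<phi> q) \<le>
          (2 + CL * R + R * CL) * mdist euclidean_metric p q"
        by (simp add: algebra_simps)
    qed
    then have "hnull euclidean_metric ?d K"
      using graph by (rule hnull_subset)
    then have "hausdorff_dim euclidean_metric K \<le> ereal ?d"
      by (rule hausdorff_dim_le_if_hnull) (use s in \<open>auto intro: add_pos_nonneg\<close>)
    then show ?thesis
      unfolding plus_ereal.simps(1) add.commute[of _ s] .
  qed
  then show ?thesis
    by (rule ereal_le_epsilon2)
qed

text \<open>The position A y is continuous in \<open>y\<close> and independent of time. Hence the
  chosen curves fill a continuous image of a compact set, and one bound for \<open>A\<close> on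
  \<open>Y\<close> serves all \<tau>.\<close>

lemma X_mat_kakeya_in_defect_variety:
  fixes B :: "real^'m^'m::finite"
  assumes Y: "compact Y"
  obtains r where "r > 0" "\<And>W \<tau>. cball 0 r \<subseteq> W \<Longrightarrow>
    \<exists>K. kakeya_set W {-\<tau>..\<tau>} Y (X_mat B) K \<and> K \<subseteq> defect_variety B"
proof -
  obtain A where A: "linear A" "\<And>\<eta> y. \<eta> \<in> defect_space B \<Longrightarrow> \<eta> \<bullet> A y = 0"
    "\<And>\<eta> y. \<eta> \<in> defect_space B \<Longrightarrow> (\<eta> v* B) \<bullet> A y = \<eta> \<bullet> y"
    using defect_space_position[of B] by blast
  have blA: "bounded_linear A"
    using A(1) by (simp add: linear_conv_bounded_linear)
  have "bounded (A ` Y)"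
    using compact_imp_bounded[OF Y] blA by (rule bounded_linear_image)
  then obtain r where r: "r > 0" "\<And>y. y \<in> Y \<Longrightarrow> norm (A y) \<le> r"
    unfolding bounded_pos by auto
  show ?thesis
  proof (rule that[OF r(1)])
    fix W :: "(real^'m) set" and \<tau> :: real assume W: "cball 0 r \<subseteq> W"
    define F where "F = (\<lambda>(y, t). (X_mat B (A y) t y, t::real))"
    define K where "K = F ` (Y \<times> {-\<tau>..\<tau>})"
    have "continuous_on (Y \<times> {-\<tau>..\<tau>}) F"
      unfolding F_def case_prod_unfold X_mat_eq
      by (intro continuous_intros bounded_linear.continuous_on[OF blA]
          bounded_linear.continuous_on[OF matrix_vector_mul_bounded_linear])
    then have "compact K"
      unfolding K_def using Y by (intro compact_continuous_image compact_Times) auto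
    moreover have "\<exists>w\<in>W. kakeya_curve {-\<tau>..\<tau>} (X_mat B) y w \<subseteq> K" if "y \<in> Y" for y
    proof
      show "A y \<in> W"
        using W r(2)[OF that] by auto
      show "kakeya_curve {-\<tau>..\<tau>} (X_mat B) y (A y) \<subseteq> K"
        unfolding kakeya_curve_def K_def F_def using that by force
    qed
    ultimately have "kakeya_set W {-\<tau>..\<tau>} Y (X_mat B) K"
      unfolding kakeya_set_def by blast
    moreover have "K \<subseteq> defect_variety B"
    proof
      fix p assume "p \<in> K"
      then obtain y t where p: "p = (X_mat B (A y) t y, t)"
        unfolding K_def F_def by auto
      \<comment> \<open>Both \<eta> \<bullet> x and t (B^T \<eta> \<bullet> x) equal t (\<eta>
        \<bullet> y) + t^2 (\<eta> \<bullet> B y); the cubic term of the latter vanishes because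
        \<eta> is orthogonal to the range of B^2.\<close>
      have "defect_poly B \<eta> p = 0" if \<eta>: "\<eta> \<in> defect_space B" for \<eta>
        using A(2,3)[OF \<eta>] defect_space_inner_square[OF \<eta>]
        by (simp add: defect_poly_def p X_mat_eq inner_add_right dot_lmul_matrix
            algebra_simps power2_eq_square)
      then show "p \<in> defect_variety B"
        by (simp add: defect_variety_def)
    qed
    ultimately show "\<exists>K. kakeya_set W {-\<tau>..\<tau>} Y (X_mat B) K \<and> K \<subseteq> defect_variety B"
      by blast
  qed
qed

theorem theorem1p3:
  fixes n :: nat and B :: "real^'m^'m::finite"
  assumes "n \<ge> 3" and "CARD('m) = n - 1"
  shows "\<exists>r>0. \<forall>\<tau>>0. \<forall>c \<rho>.
    (let W = cball c \<rho>; I = {-\<tau>..\<tau>}; Y = {y :: real^'m. \<forall>i. y $ i \<in> {-1..1}}; X = X_mat B in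
      cball 0 r \<subseteq> W \<longrightarrow> hormander_conditions W I Y X \<longrightarrow>
        (linear_kakeya_conjecture (n + rank (B ** B)) \<longrightarrow>
           d_Kak W I Y X = ereal (real n - real (rank B) + real (rank (B ** B))) \<and>
           (\<exists>K V. kakeya_set W I Y X K \<and> hausdorff_dim euclidean_metric K = d_Kak W I Y X \<and>
                  smooth_variety (n - rank B + rank (B ** B)) V \<and> K \<subseteq> V)) \<and>
        ((\<forall>N\<ge>1. linear_kakeya_conjecture N) \<longrightarrow>
           (\<exists>k::int. d_Kak W I Y X = ereal (real_of_int k))))"
proof -
  let ?Y = "{y :: real^'m. \<forall>i. y $ i \<in> {-1..1}}"
  let ?d = "real n - real (rank B) + real (rank (B ** B))"
  have n: "CARD('m) + 1 = n"
    using assms by simp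
  have "?Y = cbox (\<chi> i. -1) (\<chi> i. 1)"
    by (auto simp: mem_box_cart)
  then have "compact ?Y"
    by simp
  then obtain r where r: "r > 0" "\<And>W \<tau>. cball 0 r \<subseteq> W \<Longrightarrow>
    \<exists>K. kakeya_set W {-\<tau>..\<tau>} ?Y (X_mat B) K \<and> K \<subseteq> defect_variety B"
    using X_mat_kakeya_in_defect_variety[of ?Y B] by blast
  have ball: "y \<in> ?Y" if "norm y \<le> 1" for y
  proof -
    have "\<bar>y $ i\<bar> \<le> 1" for i
      using component_le_norm_cart[of y i] that by linarith
    then show ?thesis
      by (auto simp: abs_le_iff minus_le_iff)
  qed
  \<comment> \<open>This makes the truncated subtraction in the dimension of the variety agree with
    the real one.\<close>
  have "rank B \<le> n"
    using rank_bound[of B] n by simp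
  then have d: "real (n - rank B + rank (B ** B)) = ?d"
    by simp
  have main: "d_Kak W {-\<tau>..\<tau>} ?Y (X_mat B) = ereal ?d \<and>
      (\<exists>K V. kakeya_set W {-\<tau>..\<tau>} ?Y (X_mat B) K \<and>
        hausdorff_dim euclidean_metric K = d_Kak W {-\<tau>..\<tau>} ?Y (X_mat B) \<and>
        smooth_variety (n - rank B + rank (B ** B)) V \<and> K \<subseteq> V)"
    if \<tau>: "\<tau> > 0" and W: "cball 0 r \<subseteq> W" and conj: "linear_kakeya_conjecture (n + rank (B ** B))"
    for W \<tau>
  proof -
    obtain K where K: "kakeya_set W {-\<tau>..\<tau>} ?Y (X_mat B) K" "K \<subseteq> defect_variety B"
      using r(2)[OF W] by blast
    have lower: "ereal ?d \<le> hausdorff_dim euclidean_metric K'"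
      if "kakeya_set W {-\<tau>..\<tau>} ?Y (X_mat B) K'" for K'
    proof -
      have "linear_kakeya_conjecture (CARD('m) + 1 + rank (B ** B))"
        using conj unfolding n .
      from X_mat_kakeya_dim_ge[OF this \<tau> ball that] show ?thesis
        unfolding n .
    qed
    have "bounded K"
      using K(1) compact_imp_bounded by (auto simp: kakeya_set_def)
    from hausdorff_dim_bounded_subset_defect_variety[OF this K(2)]
    have "hausdorff_dim euclidean_metric K \<le> ereal ?d"
      unfolding n d .
    with lower[OF K(1)] have dimK: "hausdorff_dim euclidean_metric K = ereal ?d"
      by (rule antisym[rotated])
    have "d_Kak W {-\<tau>..\<tau>} ?Y (X_mat B) = ereal ?d"
      unfolding d_Kak_def
    proof (rule antisym)
      show "(INF K \<in> {K. kakeya_set W {-\<tau>..\<tau>} ?Y (X_mat B) K}. hausdorff_dim euclidean_metric K)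
          \<le> ereal ?d"
        using K(1) dimK by (intro INF_lower2[of K]) auto
    qed (use lower in \<open>auto intro: INF_greatest\<close>)
    moreover have "smooth_variety (n - rank B + rank (B ** B)) (defect_variety B)"
      using smooth_variety_defect_variety[of B] unfolding n .
    ultimately show ?thesis
      using K dimK by auto
  qed
  have int: "\<exists>k::int. d_Kak W {-\<tau>..\<tau>} ?Y (X_mat B) = ereal (real_of_int k)"
    if "\<tau> > 0" "cball 0 r \<subseteq> W" "\<forall>N\<ge>1. linear_kakeya_conjecture N" for W \<tau>
  proof -
    have "linear_kakeya_conjecture (n + rank (B ** B))"
      using that(3) assms(1) by simp
    with main that(1,2) show ?thesis
      by (intro exI[of _ "int n - int (rank B) + int (rank (B ** B))"]) simp
  qed
  show ?thesis
    unfolding Let_def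
  proof (intro exI[of _ r] conjI allI impI)
    show "0 < r"
      by (rule r(1))
  next
    fix \<tau> \<rho> :: real and c :: "real^'m"
    assume a: "0 < \<tau>" "cball 0 r \<subseteq> cball c \<rho>"
    {
      assume "linear_kakeya_conjecture (n + rank (B ** B))"
      note * = main[OF a this]
      show "d_Kak (cball c \<rho>) {-\<tau>..\<tau>} ?Y (X_mat B) = ereal ?d"
        by (rule *[THEN conjunct1])
      show "\<exists>K V. kakeya_set (cball c \<rho>) {-\<tau>..\<tau>} ?Y (X_mat B) K \<and>
          hausdorff_dim euclidean_metric K = d_Kak (cball c \<rho>) {-\<tau>..\<tau>} ?Y (X_mat B) \<and>
          smooth_variety (n - rank B + rank (B ** B)) V \<and> K \<subseteq> V"
        by (rule *[THEN conjunct2])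
    }
    assume "\<forall>N\<ge>1. linear_kakeya_conjecture N"
    then show "\<exists>k::int. d_Kak (cball c \<rho>) {-\<tau>..\<tau>} ?Y (X_mat B) = ereal (real_of_int k)"
      by (rule int[OF a])
  qed
qed

end
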